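(* Let $M$ be an irreducible based module of rank $4$ over the complex representation ring $r(S_4)$ of the symmetric group $S_4$. Then $M$ is equivalent to one of the following based modules $M_{4,1},\dots,M_{4,7}$, given by the matrices of $V_\psi,V_{\rho_1},V_{\rho_2}$ (with $V_{\rho_3}=V_\psi V_{\rho_2}$ acting by the product of the matrices of $V_\psi$ and $V_{\rho_2}$). Here $E_4$ is the $4\times4$ identity matrix. $M_{4,1}$: $V_\psi\mapsto E_4$, $V_{\rho_1}\mapsto\begin{pmatrix}0&0&1&1\\0&2&0&0\\1&0&0&1\\1&0&1&0\end{pmatrix}$, $V_{\rho_2}\mapsto\begin{pmatrix}0&1&0&0\\1&2&1&1\\0&1&0&0\\0&1&0&0\end{pmatrix}$; $M_{4,2}$: $V_\psi\mapsto E_4$, $V_{\rho_1}\mapsto 2E_4$, $V_{\rho_2}\mapsto\begin{pmatrix}0&1&1&1\\1&0&1&1\\1&1&0&1\\1&1&1&0\end{pmatrix}$; $M_{4,3}$: $V_\psi\mapsto\begin{pmatrix}0&1&0&0\\1&0&0&0\\0&0&1&0\\0&0&0&1\end{pmatrix}$, $V_{\rho_1}\mapsto\begin{pmatrix}1&1&0&0\\1&1&0&0\\0&0&2&0\\0&0&0&2\end{pmatrix}$, $V_{\rho_2}\mapsto\begin{pmatrix}1&0&1&1\\0&1&1&1\\1&1&0&1\\1&1&1&0\end{pmatrix}$; $M_{4,4}$: $V_\psi$ and $V_{\rho_1}$ as in $M_{4,3}$, $V_{\rho_2}\mapsto\begin{pmatrix}0&1&1&1\\1&0&1&1\\1&1&0&1\\1&1&1&0\end{pmatrix}$;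 $M_{4,5}$: $V_\psi\mapsto\begin{pmatrix}0&1&0&0\\1&0&0&0\\0&0&0&1\\0&0&1&0\end{pmatrix}$, $V_{\rho_1}\mapsto\begin{pmatrix}1&1&0&0\\1&1&0&0\\0&0&1&1\\0&0&1&1\end{pmatrix}$, $V_{\rho_2}\mapsto\begin{pmatrix}0&1&1&1\\1&0&1&1\\1&1&0&1\\1&1&1&0\end{pmatrix}$; $M_{4,6}$: $V_\psi$ and $V_{\rho_1}$ as in $M_{4,5}$, $V_{\rho_2}\mapsto\begin{pmatrix}0&1&1&1\\1&0&1&1\\1&1&1&0\\1&1&0&1\end{pmatrix}$; $M_{4,7}$: $V_\psi$ and $V_{\rho_1}$ as in $M_{4,5}$, $V_{\rho_2}\mapsto\begin{pmatrix}1&0&1&1\\0&1&1&1\\1&1&1&0\\1&1&0&1\end{pmatrix}$.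
   Context: The ring $r(S_4)$ is the Grothendieck ring of finite-dimensional complex representations of $S_4$. It is commutative and free over $\mathbb{Z}$ with basis $\{1,V_\psi,V_{\rho_1},V_{\rho_2},V_{\rho_3}\}$, the classes of the irreducible representations: trivial, sign, the 2-dimensional one, the 3-dimensional standard one, and $V_{\rho_3}=V_\psi V_{\rho_2}$. The products are determined by $V_\psi^2=1$, $V_\psi V_{\rho_1}=V_{\rho_1}$, $V_\psi V_{\rho_2}=V_{\rho_3}$, $V_{\rho_1}^2=1+V_\psi+V_{\rho_1}$, $V_{\rho_1}V_{\rho_2}=V_{\rho_2}+V_{\rho_3}$, $V_{\rho_2}^2=1+V_{\rho_1}+V_{\rho_2}+V_{\rho_3}$. All basis elements are self-dual. A $\mathbb{Z}_+$-module over $r(S_4)$ is an $r(S_4)$-module $M$ (with $1$ acting as identity) together with a fixed $\mathbb{Z}$-basis in which each basis element of $r(S_4)$ acts by a matrix with non-negative integer entries. Its rank is the size of the basis. It is a based module if, moreover, the matrix of each basis element of $r(S_4)$ is symmetric (this is the general condition $a_{il}^k=a_{i^*k}^l$ on structure constants $b_i m_l=\sum_k a_{il}^k m_k$, since here $i^*=i$). It is irreducible if it is nonzero and no nonempty proper subset of the fixed basis spans an $r(S_4)$-submodule. Two $\mathbb{Z}_+$-modules are equivalent if some bijection between their fixed bases induces an isomorphism of $r(S_4)$-modules, i.e. the representing matrices are simultaneously conjugate by a permutation matrix. *)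

theory Defs
  imports "HOL-Analysis.Analysis"
begin

section \<open>The complex representation ring of the symmetric group on four letters\<close>

datatype irr = One | Psi | Rho1 | Rho2 | Rho3

lemma UNIV_irr: "(UNIV :: irr set) = {One, Psi, Rho1, Rho2, Rho3}"
  using irr.exhaust by auto

instance irr :: finite
  by standard (simp add: UNIV_irr)

lemma sum_irr: "(\<Sum>i\<in>(UNIV :: irr set). f i) = f One + f Psi + f Rho1 + f Rho2 + f Rho3"
  for f :: "irr \<Rightarrow> 'a::comm_monoid_add"
  by (simp add: UNIV_irr add.assoc)

lemma all_irr: "(\<forall>i. P i) \<longleftrightarrow> P One \<and> P Psi \<and> P Rho1 \<and> P Rho2 \<and> P Rho3"
  by (metis irr.exhaust)

text \<open>All tensor products of two irreducible representations of the group are multiplicity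
  free, so a product is given by the set of its constituents.\<close>

fun constituents :: "irr \<Rightarrow> irr \<Rightarrow> irr set" where
  "constituents One j = {j}"
| "constituents i One = {i}"
| "constituents Psi Psi = {One}"
| "constituents Psi Rho1 = {Rho1}"
| "constituents Psi Rho2 = {Rho3}"
| "constituents Psi Rho3 = {Rho2}"
| "constituents Rho1 Psi = {Rho1}"
| "constituents Rho1 Rho1 = {One, Psi, Rho1}"
| "constituents Rho1 Rho2 = {Rho2, Rho3}"
| "constituents Rho1 Rho3 = {Rho2, Rho3}"
| "constituents Rho2 Psi = {Rho3}"
| "constituents Rho2 Rho1 = {Rho2, Rho3}"
| "constituents Rho2 Rho2 = {One, Rho1, Rho2, Rho3}"
| "constituents Rho2 Rho3 = {Psi, Rho1, Rho2, Rho3}"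
| "constituents Rho3 Psi = {Rho2}"
| "constituents Rho3 Rho1 = {Rho2, Rho3}"
| "constituents Rho3 Rho2 = {Psi, Rho1, Rho2, Rho3}"
| "constituents Rho3 Rho3 = {One, Rho1, Rho2, Rho3}"

definition fusion_coeff :: "irr \<Rightarrow> irr \<Rightarrow> irr \<Rightarrow> int" where
  "fusion_coeff i j k = (if k \<in> constituents i j then 1 else 0)"

lemma fusion_coeff_commute: "fusion_coeff i j k = fusion_coeff j i k"
  by (cases i; cases j) (simp_all add: fusion_coeff_def)

lemma fusion_coeff_assoc:
  "(\<Sum>l\<in>UNIV. fusion_coeff i j l * fusion_coeff l m k) =
   (\<Sum>l\<in>UNIV. fusion_coeff j m l * fusion_coeff i l k)"
  by (cases i; cases j; cases m; cases k) (simp_all add: fusion_coeff_def sum_irr)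

lemma fusion_assoc:
  fixes a b c :: "irr \<Rightarrow> int"
  shows "(\<Sum>l\<in>UNIV. \<Sum>m\<in>UNIV.
            (\<Sum>i\<in>UNIV. \<Sum>j\<in>UNIV. a i * b j * fusion_coeff i j l) * c m * fusion_coeff l m k) =
         (\<Sum>i\<in>UNIV. \<Sum>l\<in>UNIV.
            a i * (\<Sum>j\<in>UNIV. \<Sum>m\<in>UNIV. b j * c m * fusion_coeff j m l) * fusion_coeff i l k)"
    (is "?L = ?R")
proof -
  have "?L = (\<Sum>i\<in>UNIV. \<Sum>j\<in>UNIV. \<Sum>m\<in>UNIV. a i * b j * c m *
      (\<Sum>l\<in>UNIV. fusion_coeff i j l * fusion_coeff l m k))"
    unfolding sum_distrib_left sum_distrib_right sum.cartesian_product
    by (rule sum.reindex_bij_witness[of _ "\<lambda>(i, j, m, l). (l, m, i, j)"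
          "\<lambda>(l, m, i, j). (i, j, m, l)"]) auto
  also have "\<dots> = (\<Sum>i\<in>UNIV. \<Sum>j\<in>UNIV. \<Sum>m\<in>UNIV. a i * b j * c m *
      (\<Sum>l\<in>UNIV. fusion_coeff j m l * fusion_coeff i l k))"
    by (simp only: fusion_coeff_assoc)
  also have "\<dots> = ?R"
    unfolding sum_distrib_left sum_distrib_right sum.cartesian_product
    by (rule sum.reindex_bij_witness[of _ "\<lambda>(i, l, j, m). (i, j, m, l)"
          "\<lambda>(i, j, m, l). (i, l, j, m)"]) auto
  finally show ?thesis .
qed

typedef r_S4 = "UNIV :: (irr \<Rightarrow> int) set"
  morphisms coeff Abs_r_S4 ..

setup_lifting type_definition_r_S4

lemma r_S4_eq_iff: "x = y \<longleftrightarrow> (\<forall>i. coeff x i = coeff y i)"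
  by (metis coeff_inject ext)

instantiation r_S4 :: comm_ring_1
begin

lift_definition zero_r_S4 :: r_S4 is "\<lambda>i. 0" .
lift_definition one_r_S4 :: r_S4 is "\<lambda>i. if i = One then 1 else 0" .
lift_definition plus_r_S4 :: "r_S4 \<Rightarrow> r_S4 \<Rightarrow> r_S4" is "\<lambda>x y i. x i + y i" .
lift_definition uminus_r_S4 :: "r_S4 \<Rightarrow> r_S4" is "\<lambda>x i. - x i" .
lift_definition minus_r_S4 :: "r_S4 \<Rightarrow> r_S4 \<Rightarrow> r_S4" is "\<lambda>x y i. x i - y i" .
lift_definition times_r_S4 :: "r_S4 \<Rightarrow> r_S4 \<Rightarrow> r_S4" is
  "\<lambda>x y k. \<Sum>i\<in>UNIV. \<Sum>j\<in>UNIV. x i * y j * fusion_coeff i j k" .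

instance
proof
  fix a b c :: r_S4
  show "a * b * c = a * (b * c)"
    by transfer (simp add: fusion_assoc)
  show "a * b = b * a"
    by transfer (subst sum.swap, simp add: fusion_coeff_commute mult.commute)
  show "1 * a = a"
    by transfer (simp add: fun_eq_iff all_irr sum_irr fusion_coeff_def)
  show "(a + b) * c = a * c + b * c"
    by transfer (simp add: distrib_right sum.distrib)
  show "(0 :: r_S4) \<noteq> 1"
    by transfer (metis zero_neq_one)
qed (transfer; simp add: algebra_simps)+

end

lift_definition irr_class :: "irr \<Rightarrow> r_S4" is "\<lambda>i j. if j = i then 1 else 0" .

lemma coeff_simps [simp]:
  "coeff 0 i = 0"
  "coeff 1 i = (if i = One then 1 else 0)"
  "coeff (x + y) i = coeff x i + coeff y i"
  "coeff (- x) i = - coeff x i"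
  "coeff (x - y) i = coeff x i - coeff y i"
  "coeff (irr_class j) i = (if i = j then 1 else 0)"
  by (transfer; simp)+

lemma coeff_mult:
  "coeff (x * y) k =
     (\<Sum>i\<in>UNIV. \<Sum>j\<in>UNIV. coeff x i * coeff y j * fusion_coeff i j k)"
  by transfer simp

lemma coeff_of_int [simp]: "coeff (of_int n) i = (if i = One then n else 0)"
proof (induction n rule: int_induct[where k = 0])
qed auto

lemma irr_class_One: "irr_class One = 1"
  by (simp add: r_S4_eq_iff)

lemma irr_class_products:
  "irr_class Psi * irr_class Psi = 1"
  "irr_class Psi * irr_class Rho1 = irr_class Rho1"
  "irr_class Psi * irr_class Rho2 = irr_class Rho3"
  "irr_class Rho1 * irr_class Rho1 = 1 + irr_class Psi + irr_class Rho1"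
  "irr_class Rho1 * irr_class Rho2 = irr_class Rho2 + irr_class Rho3"
  "irr_class Rho2 * irr_class Rho2 = 1 + irr_class Rho1 + irr_class Rho2 + irr_class Rho3"
  by (simp_all add: r_S4_eq_iff coeff_mult sum_irr all_irr fusion_coeff_def)

lemma r_S4_expand: "x = (\<Sum>i\<in>UNIV. of_int (coeff x i) * irr_class i)"
  by (simp add: r_S4_eq_iff coeff_mult sum_irr all_irr fusion_coeff_def)


text \<open>The lemmas about \<open>virtual_character\<close> below embed the ring into the functions on the group
  and show that it is the ring of virtual characters of the group of
  permutations of \<open>{0, 1, 2, 3}\<close>. The three-dimensional standard representation is the
  permutation representation on four points minus the trivial one; the two-dimensional
  representation is the permutation representation on the three partitions of the four points
  into two pairs, minus the trivial one.\<close>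

definition pairings :: "nat set set set" where
  "pairings = {{{0,1},{2,3}}, {{0,2},{1,3}}, {{0,3},{1,2}}}"

fun irr_character :: "irr \<Rightarrow> (nat \<Rightarrow> nat) \<Rightarrow> int" where
  "irr_character One p = 1"
| "irr_character Psi p = sign p"
| "irr_character Rho1 p = int (card {P \<in> pairings. (`) p ` P = P}) - 1"
| "irr_character Rho2 p = int (card {i \<in> {0,1,2,3}. p i = i}) - 1"
| "irr_character Rho3 p = sign p * (int (card {i \<in> {0,1,2,3}. p i = i}) - 1)"

definition virtual_character :: "r_S4 \<Rightarrow> (nat \<Rightarrow> nat) \<Rightarrow> int" where
  "virtual_character x p = (\<Sum>i\<in>UNIV. coeff x i * irr_character i p)"

lemma card_pairings:
  "card {P \<in> pairings. Q P} =
   (if Q {{0,1},{2,3}} then 1 else 0) + (if Q {{0,2},{1,3}} then 1 else 0) + (if Q {{0,3},{1,2}} then 1 else 0)"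
proof -
  have "card {P \<in> pairings. Q P} = (\<Sum>P\<in>pairings. if Q P then 1 else 0)"
    by (simp add: pairings_def sum.If_cases Int_def conj_commute)
  also have "\<dots> = (if Q {{0,1},{2,3}} then 1 else 0) + (if Q {{0,2},{1,3}} then 1 else 0) + (if Q {{0,3},{1,2}} then 1 else 0)"
    by (simp add: pairings_def doubleton_eq_iff)
  finally show ?thesis .
qed

lemma card_points:
  "card {i \<in> {0, 1, 2, 3 :: nat}. Q i} =
   (if Q 0 then 1 else 0) + (if Q 1 then 1 else 0) + (if Q 2 then 1 else 0) + (if Q 3 then 1 else 0)"
proof -
  have "card {i \<in> {0, 1, 2, 3 :: nat}. Q i} = (\<Sum>i\<in>{0, 1, 2, 3 :: nat}. if Q i then 1 else 0)"
    by (simp add: sum.If_cases Int_def conj_commute del: insert_iff)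
  then show ?thesis by simp
qed

lemma permutes_insertE:
  assumes "p permutes insert a S" "a \<notin> S"
  obtains b q where "b \<in> insert a S" "q permutes S" "p = Transposition.transpose a b \<circ> q"
proof -
  have "p \<in> {p. p permutes insert a S}"
    using assms by simp
  then show ?thesis
    unfolding permutes_insert using that by auto
qed

lemma irr_character_cases:
  assumes "p permutes {0, 1, 2, 3 :: nat}"
  shows "(irr_character Psi p, irr_character Rho1 p, irr_character Rho2 p)
     \<in> {(1, 2, 3), (-1, 0, 1), (1, 2, -1), (1, -1, 0), (-1, 0, -1)}"
proof -
  have "p permutes insert 0 (insert 1 (insert 2 {3}))"
    using assms by simp
  then obtain a q where a: "a \<in> {0, 1, 2, 3}" and "q permutes insert 1 (insert 2 {3})"
    and p: "p = Transposition.transpose 0 a \<circ> q"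
    by (rule permutes_insertE) simp
  from this(2) obtain b r where b: "b \<in> {1, 2, 3}" and "r permutes insert 2 {3}"
    and q: "q = Transposition.transpose 1 b \<circ> r"
    by (rule permutes_insertE) simp
  from this(2) obtain c t where c: "c \<in> {2, 3}" and "t permutes {3}"
    and r: "r = Transposition.transpose 2 c \<circ> t"
    by (rule permutes_insertE) simp
  then have p: "p = Transposition.transpose 0 a \<circ> (Transposition.transpose 1 b \<circ> Transposition.transpose 2 c)"
    by (simp add: p q r)
  have s: "sign p = sign (Transposition.transpose 0 a) * (sign (Transposition.transpose 1 b) * sign (Transposition.transpose 2 c))"
    unfolding p by (simp add: sign_compose permutation_compose permutation_swap_id del: o_apply)
  show ?thesis
    using a b c unfolding irr_character.simps s card_pairings card_points
    by (elim insertE emptyE; hypsubst; simp add: p sign_swap_id Transposition.transpose_def doubleton_eq_iff)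
qed

lemma virtual_character_add: "virtual_character (x + y) p = virtual_character x p + virtual_character y p"
  by (simp add: virtual_character_def sum.distrib distrib_right)

lemma virtual_character_irr_class: "virtual_character (irr_class i) p = irr_character i p"
  by (cases i) (simp_all add: virtual_character_def sum_irr del: irr_character.simps)

lemma virtual_character_mult:
  assumes "p permutes {0, 1, 2, 3}"
  shows "virtual_character (x * y) p = virtual_character x p * virtual_character y p"
proof -
  have "irr_character Rho3 p = irr_character Psi p * irr_character Rho2 p"
       "irr_character One p = 1"
    by simp_all
  then show ?thesis
    using irr_character_cases[OF assms]
    by (simp add: virtual_character_def sum_irr coeff_mult fusion_coeff_def del: irr_character.simps)
      (elim disjE; simp add: algebra_simps del: irr_character.simps)
qed

lemma virtual_character_eqD:
  assumes "\<And>p. p permutes {0, 1, 2, 3} \<Longrightarrow> virtual_character x p = virtual_character y p"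
  shows "x = y"
proof -
  let ?t = "Transposition.transpose :: nat \<Rightarrow> _"
  note char_simps = virtual_character_def sum_irr irr_character.simps card_pairings card_points
  note [simp] = sign_compose permutation_compose permutation_swap_id sign_swap_id
    Transposition.transpose_def doubleton_eq_iff
  have v: "virtual_character z id = coeff z One + coeff z Psi + 2 * coeff z Rho1 + 3 * coeff z Rho2 + 3 * coeff z Rho3"
    "virtual_character z (?t 0 1) = coeff z One - coeff z Psi + coeff z Rho2 - coeff z Rho3"
    "virtual_character z (?t 0 1 \<circ> ?t 2 3) = coeff z One + coeff z Psi + 2 * coeff z Rho1 - coeff z Rho2 - coeff z Rho3"
    "virtual_character z (?t 0 1 \<circ> ?t 1 2) = coeff z One + coeff z Psi - coeff z Rho1"
    "virtual_character z (?t 0 1 \<circ> (?t 1 2 \<circ> ?t 2 3)) = coeff z One - coeff z Psi - coeff z Rho2 + coeff z Rho3"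
    for z
    unfolding char_simps by simp_all
  have "virtual_character x p = virtual_character y p"
    if "p \<in> {id, ?t 0 1, ?t 0 1 \<circ> ?t 2 3, ?t 0 1 \<circ> ?t 1 2, ?t 0 1 \<circ> (?t 1 2 \<circ> ?t 2 3)}" for p
    by (rule assms) (use that in \<open>auto intro!: permutes_swap_id permutes_compose permutes_id simp del: Transposition.transpose_def\<close>)
  from this[of id] this[of "?t 0 1"] this[of "?t 0 1 \<circ> ?t 2 3"] this[of "?t 0 1 \<circ> ?t 1 2"]
    this[of "?t 0 1 \<circ> (?t 1 2 \<circ> ?t 2 3)"]
  have "coeff x i = coeff y i" for i
    unfolding v by (cases i) simp_all
  then show ?thesis
    by (simp add: r_S4_eq_iff)
qed


section \<open>Modules with a distinguished basis\<close>

text \<open>An integer acts through its image in the ring, which for any unital module is the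
  action of the integers on the underlying additive group.\<close>

definition int_scale :: "(r_S4 \<Rightarrow> 'm \<Rightarrow> 'm) \<Rightarrow> int \<Rightarrow> 'm::ab_group_add \<Rightarrow> 'm" where
  "int_scale act n m = act (of_int n) m"

lemma module_int_scale:
  assumes "module act"
  shows "module (int_scale act)"
proof -
  interpret module act by fact
  show ?thesis
    by unfold_locales (simp_all add: int_scale_def scale_right_distrib scale_left_distrib)
qed

definition structure_constant ::
  "(r_S4 \<Rightarrow> 'm \<Rightarrow> 'm) \<Rightarrow> 'm::ab_group_add set \<Rightarrow> irr \<Rightarrow> 'm \<Rightarrow> 'm \<Rightarrow> int" where
  "structure_constant act B i l k = module.representation (int_scale act) B (act (irr_class i) l) k"

locale Z_plus_module = module act
  for act :: "r_S4 \<Rightarrow> 'm::ab_group_add \<Rightarrow> 'm" +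
  fixes B :: "'m set"
  assumes basis_independent: "\<not> module.dependent (int_scale act) B"
    and basis_span: "module.span (int_scale act) B = UNIV"
    and structure_constant_nonneg:
      "\<And>i l k. l \<in> B \<Longrightarrow> k \<in> B \<Longrightarrow> structure_constant act B i l k \<ge> 0"

text \<open>Every irreducible representation is self-dual, so the general condition
  \<open>a(i, l, k) = a(i*, k, l)\<close> on the structure constants says that the matrices are symmetric.\<close>

locale based_module = Z_plus_module act B
  for act :: "r_S4 \<Rightarrow> 'm::ab_group_add \<Rightarrow> 'm" and B +
  assumes structure_constant_sym:
    "\<And>i l k. l \<in> B \<Longrightarrow> k \<in> B \<Longrightarrow> structure_constant act B i l k = structure_constant act B i k l"

locale irreducible_Z_plus_module = Z_plus_module act B
  for act :: "r_S4 \<Rightarrow> 'm::ab_group_add \<Rightarrow> 'm" and B +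
  assumes nonzero: "\<exists>m::'m. m \<noteq> 0"
    and no_submodule:
      "\<And>N. N \<noteq> {} \<Longrightarrow> N \<subset> B \<Longrightarrow> \<not> module.subspace act (module.span (int_scale act) N)"

definition equivalent_modules ::
  "(r_S4 \<Rightarrow> 'm \<Rightarrow> 'm) \<Rightarrow> 'm::ab_group_add set \<Rightarrow> (r_S4 \<Rightarrow> 'n \<Rightarrow> 'n) \<Rightarrow> 'n::ab_group_add set \<Rightarrow> bool" where
  "equivalent_modules act B act' B' \<longleftrightarrow>
     (\<exists>f. module_hom act act' f \<and> bij f \<and> bij_betw f B B')"


section \<open>The seven modules of rank four\<close>

definition matrix_of_rows :: "int list list \<Rightarrow> int^4^4" where
  "matrix_of_rows rs = vector (map vector rs)"

fun irr_matrix :: "int^4^4 \<Rightarrow> int^4^4 \<Rightarrow> int^4^4 \<Rightarrow> irr \<Rightarrow> int^4^4" where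
  "irr_matrix P R1 R2 One = mat 1"
| "irr_matrix P R1 R2 Psi = P"
| "irr_matrix P R1 R2 Rho1 = R1"
| "irr_matrix P R1 R2 Rho2 = R2"
| "irr_matrix P R1 R2 Rho3 = P ** R2"

definition matrix_action ::
  "int^4^4 \<Rightarrow> int^4^4 \<Rightarrow> int^4^4 \<Rightarrow> r_S4 \<Rightarrow> int^4 \<Rightarrow> int^4" where
  "matrix_action P R1 R2 x v = (\<Sum>i\<in>UNIV. coeff x i *s (irr_matrix P R1 R2 i *v v))"

definition std_basis :: "(int^4) set" where
  "std_basis = range (\<lambda>i. axis i 1)"

definition M4_1 :: "r_S4 \<Rightarrow> int^4 \<Rightarrow> int^4" where
  "M4_1 = matrix_action
     (mat 1)
     (matrix_of_rows [[0,0,1,1], [0,2,0,0], [1,0,0,1], [1,0,1,0]])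
     (matrix_of_rows [[0,1,0,0], [1,2,1,1], [0,1,0,0], [0,1,0,0]])"

definition M4_2 :: "r_S4 \<Rightarrow> int^4 \<Rightarrow> int^4" where
  "M4_2 = matrix_action
     (mat 1)
     (mat 2)
     (matrix_of_rows [[0,1,1,1], [1,0,1,1], [1,1,0,1], [1,1,1,0]])"

definition M4_3 :: "r_S4 \<Rightarrow> int^4 \<Rightarrow> int^4" where
  "M4_3 = matrix_action
     (matrix_of_rows [[0,1,0,0], [1,0,0,0], [0,0,1,0], [0,0,0,1]])
     (matrix_of_rows [[1,1,0,0], [1,1,0,0], [0,0,2,0], [0,0,0,2]])
     (matrix_of_rows [[1,0,1,1], [0,1,1,1], [1,1,0,1], [1,1,1,0]])"

definition M4_4 :: "r_S4 \<Rightarrow> int^4 \<Rightarrow> int^4" where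
  "M4_4 = matrix_action
     (matrix_of_rows [[0,1,0,0], [1,0,0,0], [0,0,1,0], [0,0,0,1]])
     (matrix_of_rows [[1,1,0,0], [1,1,0,0], [0,0,2,0], [0,0,0,2]])
     (matrix_of_rows [[0,1,1,1], [1,0,1,1], [1,1,0,1], [1,1,1,0]])"

definition M4_5 :: "r_S4 \<Rightarrow> int^4 \<Rightarrow> int^4" where
  "M4_5 = matrix_action
     (matrix_of_rows [[0,1,0,0], [1,0,0,0], [0,0,0,1], [0,0,1,0]])
     (matrix_of_rows [[1,1,0,0], [1,1,0,0], [0,0,1,1], [0,0,1,1]])
     (matrix_of_rows [[0,1,1,1], [1,0,1,1], [1,1,0,1], [1,1,1,0]])"

definition M4_6 :: "r_S4 \<Rightarrow> int^4 \<Rightarrow> int^4" where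
  "M4_6 = matrix_action
     (matrix_of_rows [[0,1,0,0], [1,0,0,0], [0,0,0,1], [0,0,1,0]])
     (matrix_of_rows [[1,1,0,0], [1,1,0,0], [0,0,1,1], [0,0,1,1]])
     (matrix_of_rows [[0,1,1,1], [1,0,1,1], [1,1,1,0], [1,1,0,1]])"

definition M4_7 :: "r_S4 \<Rightarrow> int^4 \<Rightarrow> int^4" where
  "M4_7 = matrix_action
     (matrix_of_rows [[0,1,0,0], [1,0,0,0], [0,0,0,1], [0,0,1,0]])
     (matrix_of_rows [[1,1,0,0], [1,1,0,0], [0,0,1,1], [0,0,1,1]])
     (matrix_of_rows [[1,0,1,1], [0,1,1,1], [1,1,1,0], [1,1,0,1]])"

lemma int_matrix_vector_scale: "A *v (c *s v) = c *s (A *v v)" for A :: "int^4^4"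
  by (simp add: vec_eq_iff matrix_vector_mult_def sum_4 algebra_simps)

lemma matrix_action_irr_class: "matrix_action P R1 R2 (irr_class i) v = irr_matrix P R1 R2 i *v v"
  by (cases i) (simp_all add: matrix_action_def sum_irr)

lemma int_scale_matrix_action: "int_scale (matrix_action P R1 R2) n v = n *s v"
  by (simp add: int_scale_def matrix_action_def sum_irr)

lemma module_matrix_action:
  assumes "\<And>i j. irr_matrix P R1 R2 i ** irr_matrix P R1 R2 j =
    (\<Sum>k\<in>constituents i j. irr_matrix P R1 R2 k)"
  shows "module (matrix_action P R1 R2)"
proof
  fix a b :: r_S4 and x y :: "int^4"
  let ?A = "irr_matrix P R1 R2" and ?act = "matrix_action P R1 R2"
  show "?act a (x + y) = ?act a x + ?act a y"
    by (simp add: matrix_action_def matrix_vector_right_distrib vector_add_ldistrib sum.distrib)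
  show "?act (a + b) x = ?act a x + ?act b x"
    by (simp add: matrix_action_def vector_sadd_rdistrib sum.distrib)
  show "?act 1 x = x"
    by (simp add: matrix_action_def sum_irr)
  define W where "W i = ?A i *v x" for i
  have W: "?A i *v W j = (\<Sum>k\<in>UNIV. fusion_coeff i j k *s W k)" for i j
    unfolding W_def matrix_vector_mul_assoc assms
    by (cases i; cases j)
      (simp_all add: sum_irr fusion_coeff_def matrix_vector_mult_add_rdistrib add_ac)
  have distrib: "A *v (\<Sum>i\<in>UNIV. c i *s v i) = (\<Sum>i\<in>UNIV. c i *s (A *v v i))"
    for A :: "int^4^4" and c :: "irr \<Rightarrow> int" and v
    by (simp add: sum_irr matrix_vector_right_distrib int_matrix_vector_scale)
  have "?act a (?act b x) =
      (\<Sum>i\<in>UNIV. \<Sum>j\<in>UNIV. \<Sum>k\<in>UNIV. (coeff a i * coeff b j * fusion_coeff i j k) *s W k)"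
    unfolding matrix_action_def W_def[symmetric] distrib W
    by (simp add: vec_eq_iff sum_distrib_left mult.assoc)
  also have "\<dots> = (\<Sum>k\<in>UNIV. \<Sum>i\<in>UNIV. \<Sum>j\<in>UNIV. (coeff a i * coeff b j * fusion_coeff i j k) *s W k)"
    by (subst (2) sum.swap, subst sum.swap) (rule refl)
  also have "\<dots> = ?act (a * b) x"
    unfolding matrix_action_def W_def[symmetric]
    by (simp add: vec_eq_iff coeff_mult sum_distrib_right)
  finally show "?act a (?act b x) = ?act (a * b) x" .
qed

lemma axis_eq_iff: "axis i (1 :: int) = axis j 1 \<longleftrightarrow> i = j"
  by (auto simp: axis_def vec_eq_iff)

lemma based_module_matrix_action:
  assumes prod: "\<And>i j. irr_matrix P R1 R2 i ** irr_matrix P R1 R2 j =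
      (\<Sum>k\<in>constituents i j. irr_matrix P R1 R2 k)"
    and nonneg: "\<And>i k l. irr_matrix P R1 R2 i $ k $ l \<ge> 0"
    and sym: "\<And>i k l. irr_matrix P R1 R2 i $ k $ l = irr_matrix P R1 R2 i $ l $ k"
  shows "based_module (matrix_action P R1 R2) std_basis"
proof -
  let ?act = "matrix_action P R1 R2"
  interpret A: module ?act
    using prod by (rule module_matrix_action)
  interpret Z: module "int_scale ?act"
    using A.module_axioms by (rule module_int_scale)
  note [simp] = int_scale_matrix_action
  have span: "Z.span std_basis = UNIV"
  proof -
    have "w \<in> Z.span std_basis" for w
    proof -
      have "(\<Sum>i\<in>UNIV. int_scale ?act (w $ i) (axis i 1)) \<in> Z.span std_basis"
        by (intro Z.span_sum Z.span_scale Z.span_base) (simp add: std_basis_def)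
      then show ?thesis
        by (simp add: basis_expansion)
    qed
    then show ?thesis by blast
  qed
  have indep: "Z.independent std_basis"
  proof
    assume "Z.dependent std_basis"
    moreover have "finite std_basis"
      by (simp add: std_basis_def)
    ultimately obtain u j where u: "(\<Sum>v\<in>std_basis. u v *s v) = 0" and j: "u (axis j 1) \<noteq> 0"
      by (auto simp: Z.dependent_finite std_basis_def)
    have "inj (\<lambda>i::4. axis i (1 :: int))"
      by (simp add: inj_def axis_eq_iff)
    with u have "(\<Sum>i\<in>UNIV. u (axis i 1) *s axis i (1 :: int)) = (0 :: int^4)"
      by (simp add: std_basis_def sum.reindex)
    then have "(\<chi> i. u (axis i 1)) = (0 :: int^4)"
      using basis_expansion[of "\<chi> i. u (axis i 1) :: int^4"] by simp
    with j show False
      by (simp add: vec_eq_iff)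
  qed
  have rep: "Z.representation std_basis w (axis k 1) = w $ k" for w k
  proof -
    have "Z.representation std_basis w (axis k 1) =
        Z.representation std_basis (\<Sum>i\<in>UNIV. int_scale ?act (w $ i) (axis i 1)) (axis k 1)"
      by (simp add: basis_expansion)
    also have "\<dots> = (\<Sum>i\<in>UNIV. w $ i * Z.representation std_basis (axis i 1) (axis k 1))"
      using indep span by (simp add: Z.representation_sum Z.representation_scale del: int_scale_matrix_action)
    also have "\<dots> = (\<Sum>i\<in>UNIV. if i = k then w $ i else 0)"
      using indep by (intro sum.cong) (auto simp: Z.representation_basis std_basis_def axis_eq_iff)
    finally show ?thesis
      by simp
  qed
  have entry: "structure_constant ?act std_basis i (axis l 1) (axis k 1) = irr_matrix P R1 R2 i $ k $ l" for i k l
    unfolding structure_constant_def rep matrix_action_irr_class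
    by (simp add: matrix_vector_mult_def axis_def if_distrib cong: if_cong)
  have std_basisE: "\<exists>i. b = axis i 1" if "b \<in> std_basis" for b
    using that by (auto simp: std_basis_def)
  show ?thesis
    using indep span by unfold_locales (auto dest!: std_basisE simp: entry nonneg sym)
qed

lemma matrix_of_rows_nth:
  "matrix_of_rows [[a11,a12,a13,a14],[a21,a22,a23,a24],[a31,a32,a33,a34],[a41,a42,a43,a44]] $ 1 =
     vector [a11,a12,a13,a14]"
  "matrix_of_rows [[a11,a12,a13,a14],[a21,a22,a23,a24],[a31,a32,a33,a34],[a41,a42,a43,a44]] $ 2 =
     vector [a21,a22,a23,a24]"
  "matrix_of_rows [[a11,a12,a13,a14],[a21,a22,a23,a24],[a31,a32,a33,a34],[a41,a42,a43,a44]] $ 3 =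
     vector [a31,a32,a33,a34]"
  "matrix_of_rows [[a11,a12,a13,a14],[a21,a22,a23,a24],[a31,a32,a33,a34],[a41,a42,a43,a44]] $ 4 =
     vector [a41,a42,a43,a44]"
  by (simp_all add: matrix_of_rows_def vector_def)

lemma vector_4_nth:
  "(vector [a, b, c, d] :: int^4) $ 1 = a"
  "(vector [a, b, c, d] :: int^4) $ 2 = b"
  "(vector [a, b, c, d] :: int^4) $ 3 = c"
  "(vector [a, b, c, d] :: int^4) $ 4 = d"
  by (simp_all add: vector_def)

lemma matrix_of_rows_simps:
  "matrix_of_rows [[a11, a12, a13, a14], [a21, a22, a23, a24], [a31, a32, a33, a34], [a41, a42, a43, a44]] **
     matrix_of_rows [[b11, b12, b13, b14], [b21, b22, b23, b24], [b31, b32, b33, b34], [b41, b42, b43, b44]] =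
     matrix_of_rows
      [[a11 * b11 + a12 * b21 + a13 * b31 + a14 * b41,
        a11 * b12 + a12 * b22 + a13 * b32 + a14 * b42,
        a11 * b13 + a12 * b23 + a13 * b33 + a14 * b43,
        a11 * b14 + a12 * b24 + a13 * b34 + a14 * b44],
       [a21 * b11 + a22 * b21 + a23 * b31 + a24 * b41,
        a21 * b12 + a22 * b22 + a23 * b32 + a24 * b42,
        a21 * b13 + a22 * b23 + a23 * b33 + a24 * b43,
        a21 * b14 + a22 * b24 + a23 * b34 + a24 * b44],
       [a31 * b11 + a32 * b21 + a33 * b31 + a34 * b41,
        a31 * b12 + a32 * b22 + a33 * b32 + a34 * b42,
        a31 * b13 + a32 * b23 + a33 * b33 + a34 * b43,
        a31 * b14 + a32 * b24 + a33 * b34 + a34 * b44],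
       [a41 * b11 + a42 * b21 + a43 * b31 + a44 * b41,
        a41 * b12 + a42 * b22 + a43 * b32 + a44 * b42,
        a41 * b13 + a42 * b23 + a43 * b33 + a44 * b43,
        a41 * b14 + a42 * b24 + a43 * b34 + a44 * b44]]"
  "matrix_of_rows [[a11, a12, a13, a14], [a21, a22, a23, a24], [a31, a32, a33, a34], [a41, a42, a43, a44]] +
     matrix_of_rows [[b11, b12, b13, b14], [b21, b22, b23, b24], [b31, b32, b33, b34], [b41, b42, b43, b44]] =
     matrix_of_rows [[a11 + b11, a12 + b12, a13 + b13, a14 + b14], [a21 + b21, a22 + b22, a23 + b23, a24 + b24], [a31 + b31, a32 + b32, a33 + b33, a34 + b34], [a41 + b41, a42 + b42, a43 + b43, a44 + b44]]"
  "transpose (matrix_of_rows [[a11, a12, a13, a14], [a21, a22, a23, a24], [a31, a32, a33, a34], [a41, a42, a43, a44]]) =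
     matrix_of_rows [[a11, a21, a31, a41], [a12, a22, a32, a42], [a13, a23, a33, a43], [a14, a24, a34, a44]]"
  "(\<forall>k l. matrix_of_rows [[a11, a12, a13, a14], [a21, a22, a23, a24], [a31, a32, a33, a34], [a41, a42, a43, a44]] $ k $ l \<ge> 0) \<longleftrightarrow>
     (\<forall>x \<in> {a11, a12, a13, a14, a21, a22, a23, a24, a31, a32, a33, a34, a41, a42, a43, a44}. x \<ge> 0)"
  "mat n = matrix_of_rows [[n, 0, 0, 0], [0, n, 0, 0], [0, 0, n, 0], [0, 0, 0, n]]"
  by (simp_all add: vec_eq_iff forall_4 sum_4 matrix_matrix_mult_def mat_def transpose_def
      matrix_of_rows_nth vector_4_nth)

lemma irr_matrix_products:
  assumes "P ** P = mat 1" "P ** R1 = R1" "R1 ** P = R1" "R2 ** P = P ** R2"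
    and "R1 ** R1 = mat 1 + P + R1" "R1 ** R2 = R2 + P ** R2" "R2 ** R1 = R2 + P ** R2"
    and "R2 ** R2 = mat 1 + R1 + R2 + P ** R2"
  shows "irr_matrix P R1 R2 i ** irr_matrix P R1 R2 j = (\<Sum>k\<in>constituents i j. irr_matrix P R1 R2 k)"
proof -
  note mult_simps = assms matrix_mul_assoc[symmetric] matrix_add_ldistrib add_ac
    matrix_mul_lid matrix_mul_rid
  have PP: "P ** (P ** X) = X" for X :: "int^4^4"
    using assms(1) by (simp only: matrix_mul_assoc matrix_mul_lid)
  have R1P: "R1 ** (P ** X) = R1 ** X" for X :: "int^4^4"
    using assms(3) by (simp only: matrix_mul_assoc)
  have R2P: "R2 ** (P ** X) = P ** (R2 ** X)" for X :: "int^4^4"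
    using assms(4) by (simp only: matrix_mul_assoc)
  show ?thesis
    by (cases i; cases j; simp add: PP R1P R2P mult_simps)
qed

lemma based_modules:
  "based_module M4_1 std_basis" "based_module M4_2 std_basis" "based_module M4_3 std_basis"
  "based_module M4_4 std_basis" "based_module M4_5 std_basis" "based_module M4_6 std_basis"
  "based_module M4_7 std_basis"
proof -
  have *: "based_module (matrix_action P R1 R2) std_basis"
    if "P ** P = mat 1" "P ** R1 = R1" "R1 ** P = R1" "R2 ** P = P ** R2"
      and "R1 ** R1 = mat 1 + P + R1" "R1 ** R2 = R2 + P ** R2" "R2 ** R1 = R2 + P ** R2"
      and "R2 ** R2 = mat 1 + R1 + R2 + P ** R2"
      and "\<forall>k l. P $ k $ l \<ge> 0" "\<forall>k l. R1 $ k $ l \<ge> 0" "\<forall>k l. R2 $ k $ l \<ge> 0"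
      and "transpose P = P" "transpose R1 = R1" "transpose R2 = R2"
    for P R1 R2
  proof (rule based_module_matrix_action)
    show "irr_matrix P R1 R2 i ** irr_matrix P R1 R2 j = (\<Sum>k\<in>constituents i j. irr_matrix P R1 R2 k)" for i j
      using that by (intro irr_matrix_products)
    show "irr_matrix P R1 R2 i $ k $ l \<ge> 0" for i k l
      using that by (cases i) (auto simp: mat_def matrix_matrix_mult_def intro!: sum_nonneg)
    have "transpose (irr_matrix P R1 R2 i) = irr_matrix P R1 R2 i" for i
      using that by (cases i) (simp_all add: matrix_transpose_mul)
    from arg_cong[OF this, of "\<lambda>A. A $ k $ l" for k l]
    show "irr_matrix P R1 R2 i $ k $ l = irr_matrix P R1 R2 i $ l $ k" for i k l
      by (simp only: transpose_def vec_lambda_beta)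
  qed
  show "based_module M4_1 std_basis" "based_module M4_2 std_basis" "based_module M4_3 std_basis"
    "based_module M4_4 std_basis" "based_module M4_5 std_basis" "based_module M4_6 std_basis"
    "based_module M4_7 std_basis"
    unfolding M4_1_def M4_2_def M4_3_def M4_4_def M4_5_def M4_6_def M4_7_def
    by (rule *; simp only: matrix_of_rows_simps; simp)+
qed

end

theory Submission
  imports Defs
begin

text \<open>The sign representation squares to one, so its symmetric non-negative integer matrix is the
  permutation matrix of an involution of the basis, which up to relabelling is the identity, a
  transposition or a product of two transpositions. In each case the diagonal entries of the
  equations for the squares of the other two matrices bound the sums of squares of the rows, which
  leaves few possibilities; most of them are decomposable, or contradict the off-diagonal
  entries.\<close>

section \<open>Integer quadratics\<close>

text \<open>For symmetric matrices a diagonal entry of a square is the squared norm of a row. At a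
  basis element \<open>x\<close> the two relations give the squared norms
  \<open>1 + a Psi x x + a Rho1 x x\<close> and
  \<open>1 + a Rho1 x x + a Rho2 x x + a Rho3 x x\<close>; both are linear in the entries, hence the
  bounds. The number of unknowns drops beforehand: \<open>Psi\<close> fixes \<open>Rho1\<close>
  under multiplication, so \<open>Rho1\<close> is constant along the orbits of the involution, and
  \<open>Rho2\<close> commutes with it. Irreducibility enters as connectedness, which rejects the
  solutions that split into blocks. Matrices are indexed by the basis elements themselves, so
  relabelling only means choosing another \<open>enumeration\<close>. The three involutions yield 2,
  2 and 4 solutions, and one relabelling identifies two of the last four.\<close>

text \<open>Secants of the parabola through consecutive integers: they reduce the bounds on solutions of
  quadratic equations to linear arithmetic.\<close>

lemma int_square_ge:
  fixes x k :: int
  shows "(2 * k + 1) * x \<le> x * x + k * (k + 1)"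
proof -
  have "0 \<le> (x - k) * (x - (k + 1))"
    by (cases "x \<le> k") (auto simp: mult_nonpos_nonpos)
  then show ?thesis
    by (simp add: algebra_simps)
qed

lemmas int_square_bounds = int_square_ge[of 0, simplified] int_square_ge[of 1, simplified]
  int_square_ge[of 2, simplified]

text \<open>This is the diagonal equation of \<open>Rho1\<close> at an element moved by
  \<open>Psi\<close>, where invariance makes the row \<open>x, x, y, y\<close>; for a single
  transposition it is used with \<open>y = 0\<close>.\<close>

lemma int_sum_squares_eq:
  fixes x y :: int
  assumes "2 * (x * x) + 2 * (y * y) = 1 + x" "x \<ge> 0" "y \<ge> 0"
  shows "x = 1 \<and> y = 0"
proof -
  have "x \<le> 1"
    using assms int_square_bounds[of x] int_square_bounds[of y] by linarith
  then have "x = 0 \<or> x = 1"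
    using assms by linarith
  \<comment> \<open>For \<open>x = 0\<close> the equation becomes \<open>2 * (y * y) = 1\<close>,
    impossible by parity.\<close>
  then show ?thesis
    using assms by (elim disjE) (simp_all, presburger)
qed

text \<open>This is the diagonal equation of \<open>Rho1\<close> at an element fixed by
  \<open>Psi\<close> whose row has no off-diagonal entry.\<close>

lemma int_square_eq_2_plus:
  fixes x :: int
  assumes "x * x = 2 + x" "x \<ge> 0"
  shows "x = 2"
proof -
  have "(x - 2) * (x + 1) = 0"
    using assms by (simp add: algebra_simps)
  with assms show ?thesis by auto
qed

section \<open>Classification of the matrices\<close>

lemma exists_irr: "(\<exists>i. Q i) \<longleftrightarrow> Q One \<or> Q Psi \<or> Q Rho1 \<or> Q Rho2 \<or> Q Rho3"
  by (metis irr.exhaust)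

text \<open>Only the combinatorics of the structure constants is kept. The last assumption is
  irreducibility: no proper nonempty subset of the basis is closed under all the matrices.\<close>

locale symmetric_fusion_action =
  fixes B :: "'a set" and a :: "irr \<Rightarrow> 'a \<Rightarrow> 'a \<Rightarrow> int"
  assumes card_B: "card B = 4"
    and a_One: "\<And>x y. x \<in> B \<Longrightarrow> y \<in> B \<Longrightarrow> a One x y = of_bool (x = y)"
    and a_mult: "\<And>i j x y. x \<in> B \<Longrightarrow> y \<in> B \<Longrightarrow>
      (\<Sum>z\<in>B. a i x z * a j z y) = (\<Sum>k\<in>constituents i j. a k x y)"
    and a_nonneg: "\<And>i x y. x \<in> B \<Longrightarrow> y \<in> B \<Longrightarrow> a i x y \<ge> 0"
    and a_sym: "\<And>i x y. x \<in> B \<Longrightarrow> y \<in> B \<Longrightarrow> a i x y = a i y x"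
    and a_connected: "\<And>N. N \<noteq> {} \<Longrightarrow> N \<subset> B \<Longrightarrow> \<exists>i. \<exists>x\<in>N. \<exists>y\<in>B - N. a i x y \<noteq> 0"
begin

lemma finite_B: "finite B"
  using card_B by (simp add: card_ge_0_finite)

section \<open>Enumerations of the basis and the involution given by \<open>Psi\<close>\<close>

definition enumeration :: "'a \<Rightarrow> 'a \<Rightarrow> 'a \<Rightarrow> 'a \<Rightarrow> bool" where
  "enumeration x1 x2 x3 x4 \<longleftrightarrow> B = {x1, x2, x3, x4} \<and> distinct [x1, x2, x3, x4]"

lemma enumeration_extend:
  assumes "x \<in> B" "y \<in> B" "x \<noteq> y"
  obtains z w where "enumeration x y z w"
proof -
  have "card (B - {x, y}) = 2"
    using assms card_B by (simp add: card_Diff_subset)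
  then obtain z w where "B - {x, y} = {z, w}" "z \<noteq> w"
    by (auto simp: card_2_iff)
  then have "enumeration x y z w"
    using assms unfolding enumeration_def by auto
  then show ?thesis by (rule that)
qed

lemma enumeration_exists: obtains x1 x2 x3 x4 where "enumeration x1 x2 x3 x4"
proof -
  obtain x where x: "x \<in> B"
    using card_B by (metis card.empty ex_in_conv zero_neq_numeral)
  have "B \<noteq> {x}"
    using card_B by auto
  with x obtain y where "y \<in> B" "x \<noteq> y"
    by auto
  with x enumeration_extend that show ?thesis
    by metis
qed

definition entries :: "irr \<Rightarrow> 'a \<Rightarrow> 'a \<Rightarrow> 'a \<Rightarrow> 'a \<Rightarrow> int list list" where
  "entries i x1 x2 x3 x4 = map (\<lambda>x. map (a i x) [x1, x2, x3, x4]) [x1, x2, x3, x4]"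

text \<open>By symmetry and \<open>Psi\<close> squared being one, a row is an integer vector of norm
  one with non-negative entries, hence a unit vector.\<close>

lemma Psi_row:
  assumes "x \<in> B" "y \<in> B" "a Psi x y \<noteq> 0"
  shows "a Psi x y = 1" and "\<And>z. z \<in> B \<Longrightarrow> z \<noteq> y \<Longrightarrow> a Psi x z = 0"
proof -
  have "(\<Sum>z\<in>B. a Psi x z * a Psi z x) = 1"
    using assms by (simp add: a_mult a_One)
  also have "(\<Sum>z\<in>B. a Psi x z * a Psi z x) = (\<Sum>z\<in>B. a Psi x z * a Psi x z)"
    using assms by (intro sum.cong) (auto simp: a_sym[of x])
  also have "\<dots> = a Psi x y * a Psi x y + (\<Sum>z\<in>B - {y}. a Psi x z * a Psi x z)"
    using assms finite_B by (intro sum.remove)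
  finally have *: "a Psi x y * a Psi x y + (\<Sum>z\<in>B - {y}. a Psi x z * a Psi x z) = 1" .
  have pos: "(\<Sum>z\<in>B - {y}. a Psi x z * a Psi x z) \<ge> 0"
    by (intro sum_nonneg) simp
  have ge: "a Psi x y \<ge> 1"
    using assms a_nonneg[of x y Psi] by simp
  have "a Psi x y * a Psi x y \<ge> a Psi x y"
    using mult_right_mono[OF ge, of "a Psi x y"] ge by simp
  with * pos ge show one: "a Psi x y = 1"
    by linarith
  with * have z: "(\<Sum>z\<in>B - {y}. a Psi x z * a Psi x z) = 0"
    by simp
  show "a Psi x z = 0" if "z \<in> B" "z \<noteq> y" for z
    using z that finite_B by (subst (asm) sum_nonneg_eq_0_iff) auto
qed

lemma Psi_row_ex:
  assumes "x \<in> B"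
  obtains y where "y \<in> B" "a Psi x y \<noteq> 0"
proof -
  have "(\<Sum>z\<in>B. a Psi x z * a Psi z x) = 1"
    using assms by (simp add: a_mult a_One)
  then have "\<exists>y\<in>B. a Psi x y * a Psi y x \<noteq> 0"
    using sum.neutral[of B "\<lambda>z. a Psi x z * a Psi z x"] by fastforce
  with that show ?thesis by auto
qed

text \<open>If \<open>x\<close> is moved to \<open>y\<close>, symmetry clears the rows and columns
  of both, and the other two elements are either swapped or fixed. The identity case names no
  enumeration, since there it is chosen later to suit \<open>Rho1\<close>.\<close>

lemma Psi_cases:
  obtains (trivial) "\<forall>x\<in>B. \<forall>y\<in>B. a Psi x y = of_bool (x = y)"
  | (swap) x1 x2 x3 x4 where "enumeration x1 x2 x3 x4"
      "entries Psi x1 x2 x3 x4 = [[0,1,0,0], [1,0,0,0], [0,0,1,0], [0,0,0,1]]"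
  | (double_swap) x1 x2 x3 x4 where "enumeration x1 x2 x3 x4"
      "entries Psi x1 x2 x3 x4 = [[0,1,0,0], [1,0,0,0], [0,0,0,1], [0,0,1,0]]"
proof (cases "\<forall>x\<in>B. a Psi x x \<noteq> 0")
  case True
  show ?thesis
  proof (rule trivial, intro ballI)
    fix x y assume "x \<in> B" "y \<in> B"
    with True show "a Psi x y = of_bool (x = y)"
      using Psi_row(1)[of x x] Psi_row(2)[of x x y] by (cases "x = y") simp_all
  qed
next
  case False
  then obtain x where x: "x \<in> B" "a Psi x x = 0"
    by auto
  from Psi_row_ex[OF x(1)] obtain y where y: "y \<in> B" "a Psi x y \<noteq> 0"
    by auto
  with x have "x \<noteq> y" by auto
  with x y obtain z w where enum: "enumeration x y z w"
    by (metis enumeration_extend)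
  then have B: "B = {x, y, z, w}" and d: "distinct [x, y, z, w]"
    by (auto simp: enumeration_def)
  have yx: "a Psi y x \<noteq> 0"
    using x y a_sym by metis
  note rows = Psi_row[OF x(1) y] Psi_row[OF y(1) x(1) yx]
  have xy: "a Psi x y = 1" "a Psi x z = 0" "a Psi x w = 0" "a Psi y x = 1" "a Psi y y = 0"
      "a Psi y z = 0" "a Psi y w = 0"
    using rows B d by auto
  then have zw: "a Psi z x = 0" "a Psi w x = 0" "a Psi z y = 0" "a Psi w y = 0" "a Psi w z = a Psi z w"
    using xy B a_sym[of z x Psi] a_sym[of w x Psi] a_sym[of z y Psi] a_sym[of w y Psi]
      a_sym[of w z Psi] by simp_all
  show ?thesis
  proof (cases "a Psi z z = 0")
    case True
    obtain u where "u \<in> B" "a Psi z u \<noteq> 0"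
      using Psi_row_ex[of z] B by blast
    then have "a Psi z w \<noteq> 0"
      unfolding B using zw True by auto
    then have "a Psi z w = 1" "a Psi w w = 0"
      using Psi_row(1)[of z w] Psi_row(2)[of w z w] B d zw by auto
    then show ?thesis
      using x xy zw True by (intro double_swap[OF enum]) (simp add: entries_def)
  next
    case False
    then have z: "a Psi z z = 1" "a Psi z w = 0"
      using Psi_row(1)[of z z] Psi_row(2)[of z z w] B d by auto
    obtain u where "u \<in> B" "a Psi w u \<noteq> 0"
      using Psi_row_ex[of w] B by blast
    then have "a Psi w w \<noteq> 0"
      unfolding B using zw z by auto
    then have "a Psi w w = 1"
      using Psi_row(1)[of w w] B by simp
    then show ?thesis
      using x xy zw z by (intro swap[OF enum]) (simp add: entries_def)
  qed
qed

section \<open>The relations written out for a fixed enumeration\<close>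

context
  fixes x1 x2 x3 x4 :: 'a
  assumes enum: "enumeration x1 x2 x3 x4"
begin

lemma mem: "x1 \<in> B" "x2 \<in> B" "x3 \<in> B" "x4 \<in> B"
  using enum by (auto simp: enumeration_def)

lemma diff: "x1 \<noteq> x2" "x1 \<noteq> x3" "x1 \<noteq> x4" "x2 \<noteq> x1" "x2 \<noteq> x3" "x2 \<noteq> x4"
    "x3 \<noteq> x1" "x3 \<noteq> x2" "x3 \<noteq> x4" "x4 \<noteq> x1" "x4 \<noteq> x2" "x4 \<noteq> x3"
  using enum by (auto simp: enumeration_def)

lemma mult4:
  assumes "x \<in> B" "y \<in> B"
  shows "a i x x1 * a j x1 y + a i x x2 * a j x2 y + a i x x3 * a j x3 y + a i x x4 * a j x4 y =
    (\<Sum>k\<in>constituents i j. a k x y)"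
  using a_mult[OF assms, of i j] enum by (simp add: enumeration_def add.assoc)

lemma sym4: "a i x2 x1 = a i x1 x2" "a i x3 x1 = a i x1 x3" "a i x4 x1 = a i x1 x4"
    "a i x3 x2 = a i x2 x3" "a i x4 x2 = a i x2 x4" "a i x4 x3 = a i x3 x4"
  by (simp_all add: a_sym mem)

text \<open>These are the instances \<open>{x1}\<close>, \<open>{x2}\<close>, \<open>{x4}\<close>
  and \<open>{x1, x2}\<close> of connectedness, the only ones that the case analysis calls
  for.\<close>

lemma connected4:
    "\<exists>i. a i x1 x2 \<noteq> 0 \<or> a i x1 x3 \<noteq> 0 \<or> a i x1 x4 \<noteq> 0"
    "\<exists>i. a i x1 x2 \<noteq> 0 \<or> a i x2 x3 \<noteq> 0 \<or> a i x2 x4 \<noteq> 0"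
    "\<exists>i. a i x1 x4 \<noteq> 0 \<or> a i x2 x4 \<noteq> 0 \<or> a i x3 x4 \<noteq> 0"
    "\<exists>i. a i x1 x3 \<noteq> 0 \<or> a i x1 x4 \<noteq> 0 \<or> a i x2 x3 \<noteq> 0 \<or> a i x2 x4 \<noteq> 0"
proof -
  have B: "B - {x1} = {x2, x3, x4}" "B - {x2} = {x1, x3, x4}" "B - {x4} = {x1, x2, x3}"
      "B - {x1, x2} = {x3, x4}"
    using enum by (auto simp: enumeration_def)
  have "{x1} \<subset> B" "{x2} \<subset> B" "{x4} \<subset> B" "{x1, x2} \<subset> B"
    using B mem by blast+
  from this[THEN a_connected[rotated]] show
    "\<exists>i. a i x1 x2 \<noteq> 0 \<or> a i x1 x3 \<noteq> 0 \<or> a i x1 x4 \<noteq> 0"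
    "\<exists>i. a i x1 x2 \<noteq> 0 \<or> a i x2 x3 \<noteq> 0 \<or> a i x2 x4 \<noteq> 0"
    "\<exists>i. a i x1 x4 \<noteq> 0 \<or> a i x2 x4 \<noteq> 0 \<or> a i x3 x4 \<noteq> 0"
    "\<exists>i. a i x1 x3 \<noteq> 0 \<or> a i x1 x4 \<noteq> 0 \<or> a i x2 x3 \<noteq> 0 \<or> a i x2 x4 \<noteq> 0"
    unfolding B by (auto simp: sym4)
qed

lemmas nonneg4 = a_nonneg[OF mem(1) mem(1)] a_nonneg[OF mem(1) mem(2)] a_nonneg[OF mem(1) mem(3)]
  a_nonneg[OF mem(1) mem(4)] a_nonneg[OF mem(2) mem(2)] a_nonneg[OF mem(2) mem(3)]
  a_nonneg[OF mem(2) mem(4)] a_nonneg[OF mem(3) mem(3)] a_nonneg[OF mem(3) mem(4)] a_nonneg[OF mem(4) mem(4)]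


text \<open>As a rewrite rule this eliminates \<open>Rho3\<close>, leaving the entries of
  \<open>Psi\<close>, \<open>Rho1\<close> and \<open>Rho2\<close> as the unknowns.\<close>

lemma Rho3_eq:
  assumes "x \<in> B" "y \<in> B"
  shows "a Rho3 x y = a Psi x x1 * a Rho2 x1 y + a Psi x x2 * a Rho2 x2 y +
    a Psi x x3 * a Rho2 x3 y + a Psi x x4 * a Rho2 x4 y"
  using mult4[OF assms, of Psi Rho2] by simp

lemmas products_11 = mult4[OF mem(1) mem(1)]
lemmas products_12 = mult4[OF mem(1) mem(2)]
lemmas products_13 = mult4[OF mem(1) mem(3)]
lemmas products_14 = mult4[OF mem(1) mem(4)]
lemmas products_22 = mult4[OF mem(2) mem(2)]
lemmas products_31 = mult4[OF mem(3) mem(1)]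
lemmas products_32 = mult4[OF mem(3) mem(2)]
lemmas products_33 = mult4[OF mem(3) mem(3)]
lemmas products_34 = mult4[OF mem(3) mem(4)]
lemmas products_44 = mult4[OF mem(4) mem(4)]

lemmas products = products_11 products_12 products_13 products_14 products_22
  products_31 products_32 products_33 products_34 products_44

lemmas entry_simps = a_One mem diff sym4 Rho3_eq

text \<open>Invariance under \<open>Psi\<close> makes \<open>Rho1\<close> constant on each 2 by 2
  block, and commuting with \<open>Psi\<close> gives each block of \<open>Rho2\<close> the form
  \<open>[[u,w],[w,u]]\<close>.\<close>

lemma entries_double_swap:
  assumes "entries Psi x1 x2 x3 x4 = [[0,1,0,0], [1,0,0,0], [0,0,0,1], [0,0,1,0]]"
  shows "entries Rho1 x1 x2 x3 x4 = [[1,1,0,0], [1,1,0,0], [0,0,1,1], [0,0,1,1]]"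
    and "\<exists>s\<in>{0, 1}. \<exists>t\<in>{0, 1}. entries Rho2 x1 x2 x3 x4 =
      [[s,1-s,1,1], [1-s,s,1,1], [1,1,t,1-t], [1,1,1-t,t]]"
proof -
  have P: "a Psi x1 x1 = 0" "a Psi x1 x2 = 1" "a Psi x1 x3 = 0" "a Psi x1 x4 = 0"
      "a Psi x2 x1 = 1" "a Psi x2 x2 = 0" "a Psi x2 x3 = 0" "a Psi x2 x4 = 0"
      "a Psi x3 x1 = 0" "a Psi x3 x2 = 0" "a Psi x3 x3 = 0" "a Psi x3 x4 = 1"
      "a Psi x4 x1 = 0" "a Psi x4 x2 = 0" "a Psi x4 x3 = 1" "a Psi x4 x4 = 0"
    using assms by (simp_all add: entries_def)
  note [simp] = P entry_simps
  have r: "a Rho1 x1 x2 = a Rho1 x1 x1" "a Rho1 x2 x2 = a Rho1 x1 x1"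
      "a Rho1 x2 x3 = a Rho1 x1 x3" "a Rho1 x1 x4 = a Rho1 x1 x3" "a Rho1 x2 x4 = a Rho1 x1 x3"
      "a Rho1 x3 x4 = a Rho1 x3 x3" "a Rho1 x4 x4 = a Rho1 x3 x3"
    using products[of Psi Rho1] by simp_all
  have r': "a Rho1 x1 x1 = 1" "a Rho1 x1 x3 = 0"
    using int_sum_squares_eq[of "a Rho1 x1 x1" "a Rho1 x1 x3"] products_11[of Rho1 Rho1] nonneg4[of Rho1]
    by (simp_all add: r)
  then have r'': "a Rho1 x3 x3 = 1"
    using int_sum_squares_eq[of "a Rho1 x3 x3" "a Rho1 x1 x3"] products_33[of Rho1 Rho1] nonneg4[of Rho1]
    by (simp add: r)
  show "entries Rho1 x1 x2 x3 x4 = [[1,1,0,0], [1,1,0,0], [0,0,1,1], [0,0,1,1]]"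
    by (simp add: entries_def r r' r'')
  have s: "a Rho2 x2 x2 = a Rho2 x1 x1" "a Rho2 x2 x3 = a Rho2 x1 x4" "a Rho2 x2 x4 = a Rho2 x1 x3"
      "a Rho2 x4 x4 = a Rho2 x3 x3"
    using products[of Rho2 Psi] by simp_all
  \<comment> \<open>Here \<open>u, w\<close> lie inside a swapped pair and \<open>v, t\<close> lead
    to the other pair. Sum and difference of the equations are
    \<open>(u+w-1)^2 + (v+t)^2 = 4\<close> and \<open>(u-w)^2 + (v-t)^2 = 1\<close>; as
    \<open>v + t\<close> is positive, it is 2 and \<open>u + w = 1\<close>.\<close>
  have ss: "t = 1 \<and> v = 1 \<and> u \<in> {0, 1} \<and> w = 1 - u"
    if "u * u + w * w + v * v + t * t = 2 + u + w" "2 * (u * w) + 2 * (v * t) = 1 + u + w"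
      "u \<ge> 0" "w \<ge> 0" "v \<ge> 0" "t \<ge> 0" "v \<noteq> 0 \<or> t \<noteq> 0" for u w v t :: int
  proof -
    note sq = int_square_bounds[of u] int_square_bounds[of v] int_square_bounds[of w] int_square_bounds[of t]
    have "u \<le> 2" "w \<le> 2" "v \<le> 1" "t \<le> 1"
      using that sq by linarith+
    then have "u = 0 \<or> u = 1 \<or> u = 2" "w = 0 \<or> w = 1 \<or> w = 2" "v = 0 \<or> v = 1" "t = 0 \<or> t = 1"
      using that by linarith+
    then show ?thesis
      using that by (elim disjE) simp_all
  qed
  \<comment> \<open>\<open>Psi\<close> and \<open>Rho1\<close> do not link the two pairs, so
    \<open>Rho2\<close> has to.\<close>
  have nz: "a Rho2 x1 x3 \<noteq> 0 \<or> a Rho2 x1 x4 \<noteq> 0"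
    using connected4(4) by (auto simp: exists_irr r r' s)
  have s1: "a Rho2 x1 x4 = 1 \<and> a Rho2 x1 x3 = 1 \<and> a Rho2 x1 x1 \<in> {0, 1} \<and>
      a Rho2 x1 x2 = 1 - a Rho2 x1 x1"
    using products_11[of Rho2 Rho2] products_12[of Rho2 Rho2] nonneg4[of Rho2] nz
    by (intro ss) (simp_all add: r r' s)
  have s3: "a Rho2 x1 x4 = 1 \<and> a Rho2 x1 x3 = 1 \<and> a Rho2 x3 x3 \<in> {0, 1} \<and>
      a Rho2 x3 x4 = 1 - a Rho2 x3 x3"
    using products_33[of Rho2 Rho2] products_34[of Rho2 Rho2] nonneg4[of Rho2] nz
    by (intro ss) (simp_all add: r r'' s)
  show "\<exists>s\<in>{0, 1}. \<exists>t\<in>{0, 1}. entries Rho2 x1 x2 x3 x4 =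
      [[s,1-s,1,1], [1-s,s,1,1], [1,1,t,1-t], [1,1,1-t,t]]"
    using s1 s3
    by (intro bexI[of _ "a Rho2 x1 x1"] bexI[of _ "a Rho2 x3 x3"]) (simp_all add: entries_def s)
qed

text \<open>A nonzero entry between the swapped pair and the fixed point \<open>x3\<close> would use
  up the whole norm of the row of \<open>x1\<close>, and the relations would then cut off
  \<open>x4\<close>.\<close>

lemma Rho1_swap:
  assumes "entries Psi x1 x2 x3 x4 = [[0,1,0,0], [1,0,0,0], [0,0,1,0], [0,0,0,1]]"
  shows "a Rho1 x1 x3 = 0"
proof (rule ccontr)
  assume nz: "a Rho1 x1 x3 \<noteq> 0"
  have P: "a Psi x1 x1 = 0" "a Psi x1 x2 = 1" "a Psi x1 x3 = 0" "a Psi x1 x4 = 0"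
      "a Psi x2 x1 = 1" "a Psi x2 x2 = 0" "a Psi x2 x3 = 0" "a Psi x2 x4 = 0"
      "a Psi x3 x1 = 0" "a Psi x3 x2 = 0" "a Psi x3 x3 = 1" "a Psi x3 x4 = 0"
      "a Psi x4 x1 = 0" "a Psi x4 x2 = 0" "a Psi x4 x3 = 0" "a Psi x4 x4 = 1"
    using assms by (simp_all add: entries_def)
  note [simp] = P entry_simps
  have r: "a Rho1 x1 x2 = a Rho1 x1 x1" "a Rho1 x2 x2 = a Rho1 x1 x1"
      "a Rho1 x2 x3 = a Rho1 x1 x3" "a Rho1 x2 x4 = a Rho1 x1 x4"
    using products[of Psi Rho1] by simp_all
  have s: "a Rho2 x2 x2 = a Rho2 x1 x1" "a Rho2 x2 x3 = a Rho2 x1 x3" "a Rho2 x2 x4 = a Rho2 x1 x4"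
    using products[of Rho2 Psi] by simp_all
  \<comment> \<open>The row \<open>x, x, y, z\<close> satisfies
    \<open>2*x^2 - x + y^2 + z^2 = 1\<close> with \<open>y\<close> positive.\<close>
  have "a Rho1 x1 x1 = 0 \<and> a Rho1 x1 x3 = 1 \<and> a Rho1 x1 x4 = 0"
    using products_11[of Rho1 Rho1] nonneg4[of Rho1] nz
      int_square_bounds[of "a Rho1 x1 x1"] int_square_bounds[of "a Rho1 x1 x3"]
      int_square_bounds[of "a Rho1 x1 x4"]
    by (simp add: r)
  then have r': "a Rho1 x1 x1 = 0" "a Rho1 x1 x3 = 1" "a Rho1 x1 x4 = 0"
    by simp_all
  have r34: "a Rho1 x3 x4 = 0"
    using products_14[of Rho1 Rho1] by (simp add: r r')
  have r44: "a Rho1 x4 x4 = 2"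
    using products_44[of Rho1 Rho1] nonneg4[of Rho1]
    by (intro int_square_eq_2_plus) (simp_all add: r r' r34)
  have s34: "a Rho2 x3 x4 = 2 * a Rho2 x1 x4"
    using products_14[of Rho1 Rho2] by (simp add: r r' s)
  \<comment> \<open>The row of \<open>x4\<close> is \<open>c, c, 2*c, d\<close>, so its diagonal
    equation is \<open>6*c^2 + (d-1)^2 = 4\<close>.\<close>
  have "a Rho2 x1 x4 = 0"
    using products_44[of Rho2 Rho2] nonneg4[of Rho2]
      int_square_bounds[of "a Rho2 x1 x4"] int_square_bounds[of "a Rho2 x4 x4"]
    by (simp add: s s34 r44)
  then show False
    using connected4(3) by (simp add: exists_irr s s34 r r' r34)
qed

lemma entries_swap:
  assumes "entries Psi x1 x2 x3 x4 = [[0,1,0,0], [1,0,0,0], [0,0,1,0], [0,0,0,1]]"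
    and r13: "a Rho1 x1 x3 = 0" and r14: "a Rho1 x1 x4 = 0"
  shows "entries Rho1 x1 x2 x3 x4 = [[1,1,0,0], [1,1,0,0], [0,0,2,0], [0,0,0,2]]"
    and "\<exists>s\<in>{0, 1}. entries Rho2 x1 x2 x3 x4 =
      [[s,1-s,1,1], [1-s,s,1,1], [1,1,0,1], [1,1,1,0]]"
proof -
  have P: "a Psi x1 x1 = 0" "a Psi x1 x2 = 1" "a Psi x1 x3 = 0" "a Psi x1 x4 = 0"
      "a Psi x2 x1 = 1" "a Psi x2 x2 = 0" "a Psi x2 x3 = 0" "a Psi x2 x4 = 0"
      "a Psi x3 x1 = 0" "a Psi x3 x2 = 0" "a Psi x3 x3 = 1" "a Psi x3 x4 = 0"
      "a Psi x4 x1 = 0" "a Psi x4 x2 = 0" "a Psi x4 x3 = 0" "a Psi x4 x4 = 1"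
    using assms by (simp_all add: entries_def)
  note [simp] = P entry_simps
  have r: "a Rho1 x1 x2 = a Rho1 x1 x1" "a Rho1 x2 x2 = a Rho1 x1 x1"
      "a Rho1 x2 x3 = 0" "a Rho1 x2 x4 = 0" "a Rho1 x1 x3 = 0" "a Rho1 x1 x4 = 0"
    using products[of Psi Rho1] r13 r14 by simp_all
  have s: "a Rho2 x2 x2 = a Rho2 x1 x1" "a Rho2 x2 x3 = a Rho2 x1 x3" "a Rho2 x2 x4 = a Rho2 x1 x4"
    using products[of Rho2 Psi] by simp_all
  have r11: "a Rho1 x1 x1 = 1"
    using products_11[of Rho1 Rho1] int_sum_squares_eq[of "a Rho1 x1 x1" 0] nonneg4[of Rho1]
    by (simp add: r)
  have rr: "x = 2 \<and> y = 0" if "x * x + y * y = 2 + x" "x \<ge> 0" "y \<ge> 0" for x y :: int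
  proof -
    have "x \<le> 2" "y \<le> 1"
      using that int_square_bounds[of x] int_square_bounds[of y] by linarith+
    then have "x = 0 \<or> x = 1 \<or> x = 2" "y = 0 \<or> y = 1"
      using that by linarith+
    then show ?thesis
      using that by (elim disjE) simp_all
  qed
  have r33: "a Rho1 x3 x3 = 2 \<and> a Rho1 x3 x4 = 0"
    using products_33[of Rho1 Rho1] nonneg4[of Rho1] by (intro rr) (simp_all add: r)
  have r44: "a Rho1 x4 x4 = 2 \<and> a Rho1 x3 x4 = 0"
    using products_44[of Rho1 Rho1] nonneg4[of Rho1] by (intro rr) (simp_all add: r)
  note r' = r r11 r33 r44
  show "entries Rho1 x1 x2 x3 x4 = [[1,1,0,0], [1,1,0,0], [0,0,2,0], [0,0,0,2]]"
    by (simp add: entries_def r')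
  \<comment> \<open>The rows of \<open>x3\<close> and \<open>x4\<close> are
    \<open>f, f, h, k\<close> and \<open>g, g, k, l\<close>. The norms give
    \<open>2*f^2 + (h-1)^2 + k^2 = 4\<close> and the same for \<open>g, l\<close>; if
    \<open>f\<close> or \<open>g\<close> is nonzero, then \<open>f = g = k = 1\<close>, and the
    mixed product picks \<open>h = l = 0\<close> over the value 2.\<close>
  have ss: "f = 1 \<and> g = 1 \<and> h = 0 \<and> k = 1 \<and> l = 0"
    if "2 * (f * f) + h * h + k * k = 3 + 2 * h" "2 * (g * g) + k * k + l * l = 3 + 2 * l"
      "2 * (f * g) + h * k + k * l = 2 * k" "f \<ge> 0" "g \<ge> 0" "h \<ge> 0" "k \<ge> 0" "l \<ge> 0" "f \<noteq> 0 \<or> g \<noteq> 0"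
    for f g h k l :: int
  proof -
    note sq = int_square_bounds[of f] int_square_bounds[of g] int_square_bounds[of h]
      int_square_bounds[of k] int_square_bounds[of l]
    have "f \<le> 1" "g \<le> 1" "h \<le> 3" "l \<le> 3" "k \<le> 2"
      using that sq by linarith+
    then have "f = 0 \<or> f = 1" "g = 0 \<or> g = 1" "k = 0 \<or> k = 1 \<or> k = 2"
      "h = 0 \<or> h = 1 \<or> h = 2 \<or> h = 3" "l = 0 \<or> l = 1 \<or> l = 2 \<or> l = 3"
      using that by linarith+
    then show ?thesis
      using that by (elim disjE) simp_all
  qed
  have nz: "a Rho2 x1 x3 \<noteq> 0 \<or> a Rho2 x1 x4 \<noteq> 0"
    using connected4(4) by (auto simp: exists_irr r s)
  have s': "a Rho2 x1 x3 = 1 \<and> a Rho2 x1 x4 = 1 \<and> a Rho2 x3 x3 = 0 \<and> a Rho2 x3 x4 = 1 \<and> a Rho2 x4 x4 = 0"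
    using products_33[of Rho2 Rho2] products_34[of Rho2 Rho2] products_44[of Rho2 Rho2]
      nonneg4[of Rho2] nz
    by (intro ss) (simp_all add: r' s)
  \<comment> \<open>With the column of \<open>x3\<close> known, this entry of the square is linear
    in the two remaining unknowns.\<close>
  have s12: "a Rho2 x1 x2 = 1 - a Rho2 x1 x1"
    using products_13[of Rho2 Rho2] by (simp add: r' s s')
  have "a Rho2 x1 x1 \<in> {0, 1}"
    using s12 nonneg4[of Rho2] by auto
  then show "\<exists>s\<in>{0, 1}. entries Rho2 x1 x2 x3 x4 =
      [[s,1-s,1,1], [1-s,s,1,1], [1,1,0,1], [1,1,1,0]]"
    by (intro bexI[of _ "a Rho2 x1 x1"]) (simp_all add: entries_def s s' s12)
qed

section \<open>The case where \<open>Psi\<close> acts as the identity\<close>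

lemma entries_Psi_trivial:
  assumes "\<forall>x\<in>B. \<forall>y\<in>B. a Psi x y = of_bool (x = y)"
  shows "entries Psi x1 x2 x3 x4 = [[1,0,0,0], [0,1,0,0], [0,0,1,0], [0,0,0,1]]"
  by (simp add: entries_def assms mem diff)

lemma entries_triangle:
  assumes triv: "\<forall>x\<in>B. \<forall>y\<in>B. a Psi x y = of_bool (x = y)"
    and r1: "a Rho1 x1 x2 = 0" "a Rho1 x1 x3 = 1" "a Rho1 x1 x4 = 1"
  shows "entries Rho1 x1 x2 x3 x4 = [[0,0,1,1], [0,2,0,0], [1,0,0,1], [1,0,1,0]]"
    and "entries Rho2 x1 x2 x3 x4 = [[0,1,0,0], [1,2,1,1], [0,1,0,0], [0,1,0,0]]"
proof -
  note [simp] = triv entry_simps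
  have "a Rho1 x2 x3 = 0 \<and> a Rho1 x2 x4 = 0"
    using products_12[of Rho1 Rho1] nonneg4[of Rho1] by (simp add: r1)
  then have r: "a Rho1 x2 x3 = 0" "a Rho1 x2 x4 = 0"
    by simp_all
  have r22: "a Rho1 x2 x2 = 2"
    using products_22[of Rho1 Rho1] nonneg4[of Rho1]
    by (intro int_square_eq_2_plus) (simp_all add: r1 r)
  have eq: "a Rho1 x1 x1 + a Rho1 x3 x3 + a Rho1 x3 x4 = 1"
    using products_13[of Rho1 Rho1] by (simp add: r1 r)
  \<comment> \<open>Otherwise the diagonal entry at \<open>x3\<close> is a root of
    \<open>t^2 = 1 + t\<close>, which has no integer solution.\<close>
  have "a Rho1 x3 x4 \<noteq> 0"
  proof
    assume "a Rho1 x3 x4 = 0"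
    then have "a Rho1 x3 x3 * a Rho1 x3 x3 = 1 + a Rho1 x3 x3" "a Rho1 x3 x3 = 0 \<or> a Rho1 x3 x3 = 1"
      using products_33[of Rho1 Rho1] eq nonneg4[of Rho1] by (auto simp add: r1 r)
    then show False by auto
  qed
  then have r': "a Rho1 x3 x4 = 1" "a Rho1 x1 x1 = 0" "a Rho1 x3 x3 = 0"
    using eq nonneg4[of Rho1] by linarith+
  have r44: "a Rho1 x4 x4 = 0"
    using products_14[of Rho1 Rho1] by (simp add: r1 r r')
  note r = r1 r r22 r' r44
  show "entries Rho1 x1 x2 x3 x4 = [[0,0,1,1], [0,2,0,0], [1,0,0,1], [1,0,1,0]]"
    by (simp add: entries_def r)
  \<comment> \<open>Now \<open>Rho3\<close> equals \<open>Rho2\<close>, so the columns of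
    \<open>Rho2\<close> are eigenvectors of \<open>Rho1\<close> for the eigenvalue 2. On the
    triangle \<open>x1, x3, x4\<close> these are the constant vectors.\<close>
  have s: "a Rho2 x1 x3 = a Rho2 x1 x1" "a Rho2 x1 x4 = a Rho2 x1 x1" "a Rho2 x3 x3 = a Rho2 x1 x1"
      "a Rho2 x3 x4 = a Rho2 x1 x1" "a Rho2 x4 x4 = a Rho2 x1 x1"
      "a Rho2 x2 x3 = a Rho2 x1 x2" "a Rho2 x2 x4 = a Rho2 x1 x2"
    using products[of Rho1 Rho2] by (simp_all add: r)
  have nz: "a Rho2 x1 x2 \<noteq> 0"
    using connected4(2) by (auto simp: exists_irr r s)
  have "a Rho2 x1 x1 = 0 \<and> a Rho2 x1 x2 = 1"
    using products_11[of Rho2 Rho2] nonneg4[of Rho2] nz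
      int_square_bounds[of "a Rho2 x1 x1"] int_square_bounds[of "a Rho2 x1 x2"]
    by (simp add: r s)
  then have s': "a Rho2 x1 x1 = 0" "a Rho2 x1 x2 = 1"
    by simp_all
  have s22: "a Rho2 x2 x2 = 2"
    using products_12[of Rho2 Rho2] by (simp add: r s s')
  show "entries Rho2 x1 x2 x3 x4 = [[0,1,0,0], [1,2,1,1], [0,1,0,0], [0,1,0,0]]"
    by (simp add: entries_def s s' s22)
qed

text \<open>With diagonal entry \<open>x\<close>, the off-diagonal squares sum to
  \<open>2 - x*(x-1)\<close>. If this is nonzero it is 2, so exactly two of the entries are
  1.\<close>

lemma Rho1_trivial_row:
  assumes triv: "\<forall>x\<in>B. \<forall>y\<in>B. a Psi x y = of_bool (x = y)"
    and nz: "a Rho1 x1 x2 \<noteq> 0"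
  shows "a Rho1 x1 x2 = 1 \<and>
    (a Rho1 x1 x3 = 1 \<and> a Rho1 x1 x4 = 0 \<or> a Rho1 x1 x3 = 0 \<and> a Rho1 x1 x4 = 1)"
proof -
  note [simp] = triv entry_simps
  have eq: "a Rho1 x1 x1 * a Rho1 x1 x1 + a Rho1 x1 x2 * a Rho1 x1 x2 + a Rho1 x1 x3 * a Rho1 x1 x3 +
      a Rho1 x1 x4 * a Rho1 x1 x4 = 2 + a Rho1 x1 x1"
    using products_11[of Rho1 Rho1] by simp
  note sq = int_square_bounds[of "a Rho1 x1 x1"] int_square_bounds[of "a Rho1 x1 x2"]
    int_square_bounds[of "a Rho1 x1 x3"] int_square_bounds[of "a Rho1 x1 x4"]
  have "a Rho1 x1 x1 = 0 \<or> a Rho1 x1 x1 = 1" "a Rho1 x1 x2 = 1"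
      "a Rho1 x1 x3 = 0 \<or> a Rho1 x1 x3 = 1" "a Rho1 x1 x4 = 0 \<or> a Rho1 x1 x4 = 1"
    using eq sq nz nonneg4[of Rho1] by linarith+
  with eq show ?thesis
    by (elim disjE) simp_all
qed

context
  assumes triv: "\<forall>x\<in>B. \<forall>y\<in>B. a Psi x y = of_bool (x = y)"
    and scalar: "\<forall>x\<in>B. \<forall>y\<in>B. a Rho1 x y = (if x = y then 2 else 0)"
begin

lemma Rho2_scalar_row_eq:
  "a Rho2 x1 x1 * a Rho2 x1 x1 + a Rho2 x1 x2 * a Rho2 x1 x2 + a Rho2 x1 x3 * a Rho2 x1 x3 +
    a Rho2 x1 x4 * a Rho2 x1 x4 = 3 + 2 * a Rho2 x1 x1"
  "a Rho2 x1 x2 * a Rho2 x1 x2 + a Rho2 x2 x2 * a Rho2 x2 x2 + a Rho2 x2 x3 * a Rho2 x2 x3 +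
    a Rho2 x2 x4 * a Rho2 x2 x4 = 3 + 2 * a Rho2 x2 x2"
  using products_11[of Rho2 Rho2] products_22[of Rho2 Rho2] by (simp_all add: triv scalar entry_simps)

text \<open>With diagonal entry \<open>d\<close> the off-diagonal squares sum to
  \<open>4 - (d-1)^2\<close>. An entry 2 exhausts this sum in both rows, so \<open>{x1, x2}\<close>
  would split off.\<close>

lemma Rho2_scalar_less_2: "a Rho2 x1 x2 < 2"
proof (rule ccontr)
  note [simp] = triv scalar entry_simps
  assume "\<not> a Rho2 x1 x2 < 2"
  then have "a Rho2 x1 x3 = 0 \<and> a Rho2 x1 x4 = 0" "a Rho2 x2 x3 = 0 \<and> a Rho2 x2 x4 = 0"
    using Rho2_scalar_row_eq nonneg4[of Rho2]
      int_square_bounds[of "a Rho2 x1 x1"] int_square_bounds[of "a Rho2 x2 x2"]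
      int_square_bounds[of "a Rho2 x1 x2"] int_square_bounds[of "a Rho2 x1 x3"]
      int_square_bounds[of "a Rho2 x1 x4"] int_square_bounds[of "a Rho2 x2 x3"]
      int_square_bounds[of "a Rho2 x2 x4"]
    by linarith+
  then show False
    using connected4(4) by (simp add: exists_irr)
qed

text \<open>The number of off-diagonal ones is 4 minus a square, hence 0 or 3, and connectedness
  excludes 0.\<close>

lemma Rho2_scalar_row:
  assumes "a Rho2 x1 x3 < 2" "a Rho2 x1 x4 < 2"
  shows "a Rho2 x1 x2 = 1 \<and> a Rho2 x1 x3 = 1 \<and> a Rho2 x1 x4 = 1"
proof -
  note [simp] = triv scalar entry_simps
  have nz: "a Rho2 x1 x2 \<noteq> 0 \<or> a Rho2 x1 x3 \<noteq> 0 \<or> a Rho2 x1 x4 \<noteq> 0"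
    using connected4(1) by (simp add: exists_irr)
  have "a Rho2 x1 x1 \<le> 3"
    using Rho2_scalar_row_eq(1) int_square_bounds[of "a Rho2 x1 x1"] int_square_bounds[of "a Rho2 x1 x2"]
      int_square_bounds[of "a Rho2 x1 x3"] int_square_bounds[of "a Rho2 x1 x4"] nonneg4[of Rho2]
    by linarith
  then have "a Rho2 x1 x1 = 0 \<or> a Rho2 x1 x1 = 1 \<or> a Rho2 x1 x1 = 2 \<or> a Rho2 x1 x1 = 3"
      "a Rho2 x1 x2 = 0 \<or> a Rho2 x1 x2 = 1" "a Rho2 x1 x3 = 0 \<or> a Rho2 x1 x3 = 1"
      "a Rho2 x1 x4 = 0 \<or> a Rho2 x1 x4 = 1"
    using assms Rho2_scalar_less_2 nonneg4[of Rho2] by linarith+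
  then show ?thesis
    using Rho2_scalar_row_eq(1) nz by (elim disjE) simp_all
qed

end

end

lemma enumeration_permute:
  assumes "enumeration x1 x2 x3 x4"
  shows "enumeration x1 x2 x4 x3" "enumeration x1 x3 x2 x4" "enumeration x1 x4 x2 x3"
    "enumeration x3 x4 x1 x2"
  using assms diff[OF assms] unfolding enumeration_def by (simp_all add: insert_commute)

lemma entries_scalar:
  assumes triv: "\<forall>x\<in>B. \<forall>y\<in>B. a Psi x y = of_bool (x = y)"
    and scalar: "\<forall>x\<in>B. \<forall>y\<in>B. a Rho1 x y = (if x = y then 2 else 0)"
    and enum: "enumeration x1 x2 x3 x4"
  shows "entries Rho2 x1 x2 x3 x4 = [[0,1,1,1], [1,0,1,1], [1,1,0,1], [1,1,1,0]]"
proof -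
  have off: "a Rho2 x y = 1" if "x \<in> B" "y \<in> B" "x \<noteq> y" for x y
  proof -
    from that obtain z w where e: "enumeration x y z w"
      by (rule enumeration_extend)
    show ?thesis
      using Rho2_scalar_row[OF e triv scalar] Rho2_scalar_less_2[OF enumeration_permute(2)[OF e] triv scalar]
        Rho2_scalar_less_2[OF enumeration_permute(3)[OF e] triv scalar]
      by simp
  qed
  \<comment> \<open>The norm alone also allows 2 on the diagonal. The entry of the square at
    \<open>x, y\<close> makes the two diagonal entries sum to zero.\<close>
  have diag: "a Rho2 x x = 0" if x: "x \<in> B" for x
  proof -
    obtain y where "y \<in> B" "x \<noteq> y"
      using mem(1,2)[OF enum] diff(1)[OF enum] by auto
    with x obtain z w where e: "enumeration x y z w"
      by (rule enumeration_extend)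
    note [simp] = triv scalar off entry_simps[OF e]
    show ?thesis
      using products_12[OF e, of Rho2 Rho2] nonneg4[OF e, of Rho2] by simp
  qed
  show ?thesis
    using enum by (simp add: entries_def off diag mem[OF enum] diff[OF enum])
qed

lemma classification:
  "\<exists>x1 x2 x3 x4. enumeration x1 x2 x3 x4 \<and>
    (entries Psi x1 x2 x3 x4, entries Rho1 x1 x2 x3 x4, entries Rho2 x1 x2 x3 x4) \<in>
     {([[1,0,0,0], [0,1,0,0], [0,0,1,0], [0,0,0,1]],
       [[0,0,1,1], [0,2,0,0], [1,0,0,1], [1,0,1,0]],
       [[0,1,0,0], [1,2,1,1], [0,1,0,0], [0,1,0,0]]),
      ([[1,0,0,0], [0,1,0,0], [0,0,1,0], [0,0,0,1]],
       [[2,0,0,0], [0,2,0,0], [0,0,2,0], [0,0,0,2]],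
       [[0,1,1,1], [1,0,1,1], [1,1,0,1], [1,1,1,0]]),
      ([[0,1,0,0], [1,0,0,0], [0,0,1,0], [0,0,0,1]],
       [[1,1,0,0], [1,1,0,0], [0,0,2,0], [0,0,0,2]],
       [[1,0,1,1], [0,1,1,1], [1,1,0,1], [1,1,1,0]]),
      ([[0,1,0,0], [1,0,0,0], [0,0,1,0], [0,0,0,1]],
       [[1,1,0,0], [1,1,0,0], [0,0,2,0], [0,0,0,2]],
       [[0,1,1,1], [1,0,1,1], [1,1,0,1], [1,1,1,0]]),
      ([[0,1,0,0], [1,0,0,0], [0,0,0,1], [0,0,1,0]],
       [[1,1,0,0], [1,1,0,0], [0,0,1,1], [0,0,1,1]],
       [[0,1,1,1], [1,0,1,1], [1,1,0,1], [1,1,1,0]]),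
      ([[0,1,0,0], [1,0,0,0], [0,0,0,1], [0,0,1,0]],
       [[1,1,0,0], [1,1,0,0], [0,0,1,1], [0,0,1,1]],
       [[0,1,1,1], [1,0,1,1], [1,1,1,0], [1,1,0,1]]),
      ([[0,1,0,0], [1,0,0,0], [0,0,0,1], [0,0,1,0]],
       [[1,1,0,0], [1,1,0,0], [0,0,1,1], [0,0,1,1]],
       [[1,0,1,1], [0,1,1,1], [1,1,1,0], [1,1,0,1]])}"
proof (cases rule: Psi_cases)
  case trivial
  show ?thesis
  proof (cases "\<exists>x\<in>B. \<exists>y\<in>B. x \<noteq> y \<and> a Rho1 x y \<noteq> 0")
    case True
    then obtain x y where xy: "x \<in> B" "y \<in> B" "x \<noteq> y" "a Rho1 x y \<noteq> 0"
      by auto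
    from xy(1-3) obtain z w where e: "enumeration x y z w"
      by (rule enumeration_extend)
    have row: "a Rho1 x y = 1"
        "a Rho1 x z = 1 \<and> a Rho1 x w = 0 \<or> a Rho1 x z = 0 \<and> a Rho1 x w = 1"
      using Rho1_trivial_row[OF e trivial xy(4)] by simp_all
    \<comment> \<open>The one element that \<open>Rho1\<close> does not link to \<open>x\<close> is
      placed second, as in \<open>M4_1\<close>.\<close>
    have "\<exists>x2 x3 x4. enumeration x x2 x3 x4 \<and>
        a Rho1 x x2 = 0 \<and> a Rho1 x x3 = 1 \<and> a Rho1 x x4 = 1"
    proof (cases "a Rho1 x z = 0")
      case True
      then show ?thesis
        using row enumeration_permute(2)[OF e]
        by (intro exI[of _ z] exI[of _ y] exI[of _ w]) simp
    next
      case False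
      then show ?thesis
        using row enumeration_permute(3)[OF e]
        by (intro exI[of _ w] exI[of _ y] exI[of _ z]) simp
    qed
    then obtain x2 x3 x4 where e': "enumeration x x2 x3 x4"
      and r: "a Rho1 x x2 = 0" "a Rho1 x x3 = 1" "a Rho1 x x4 = 1"
      by auto
    show ?thesis
      using e' entries_Psi_trivial[OF e' trivial] entries_triangle[OF e' trivial r]
      by (intro exI[of _ x] exI[of _ x2] exI[of _ x3] exI[of _ x4]) simp
  next
    case False
    then have off: "\<forall>x\<in>B. \<forall>y\<in>B. x = y \<or> a Rho1 x y = 0"
      by simp
    obtain x1 x2 x3 x4 where e: "enumeration x1 x2 x3 x4"
      using enumeration_exists by blast
    have scalar: "\<forall>x\<in>B. \<forall>y\<in>B. a Rho1 x y = (if x = y then 2 else 0)"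
    proof (intro ballI)
      fix x y assume xy: "x \<in> B" "y \<in> B"
      show "a Rho1 x y = (if x = y then 2 else 0)"
      proof (cases "x = y")
        case True
        have "a Rho1 x z = 0" if "z \<in> B - {x}" for z
          using off[rule_format, OF xy(1), of z] that by auto
        then have "(\<Sum>z\<in>B. a Rho1 x z * a Rho1 z x) = a Rho1 x x * a Rho1 x x"
          using xy finite_B by (simp add: sum.remove[of B x])
        then have "a Rho1 x x = 2"
          using a_mult[of x x Rho1 Rho1] xy a_nonneg[of x x Rho1]
          by (intro int_square_eq_2_plus) (simp_all add: trivial a_One)
        with True show ?thesis by simp
      qed (use off[rule_format, OF xy] in simp)
    qed
    have "entries Rho1 x1 x2 x3 x4 = [[2,0,0,0], [0,2,0,0], [0,0,2,0], [0,0,0,2]]"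
      by (simp add: entries_def scalar mem[OF e] diff[OF e])
    then show ?thesis
      using e entries_Psi_trivial[OF e trivial] entries_scalar[OF trivial scalar e]
      by (intro exI[of _ x1] exI[of _ x2] exI[of _ x3] exI[of _ x4]) simp
  qed
next
  case (swap x1 x2 x3 x4)
  \<comment> \<open>Exchanging the two fixed points leaves the matrix of \<open>Psi\<close>
    unchanged, so \<open>Rho1_swap\<close> also covers \<open>x4\<close>.\<close>
  have "enumeration x1 x2 x4 x3"
    using swap(1) by (rule enumeration_permute)
  moreover from swap(2) have "entries Psi x1 x2 x4 x3 = [[0,1,0,0], [1,0,0,0], [0,0,1,0], [0,0,0,1]]"
    by (simp add: entries_def)
  ultimately have r14: "a Rho1 x1 x4 = 0"
    by (rule Rho1_swap)
  have r13: "a Rho1 x1 x3 = 0"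
    using swap by (rule Rho1_swap)
  note R1 = entries_swap(1)[OF swap r13 r14]
  obtain s where s: "s \<in> {0, 1}"
    and R2: "entries Rho2 x1 x2 x3 x4 = [[s,1-s,1,1], [1-s,s,1,1], [1,1,0,1], [1,1,1,0]]"
    using entries_swap(2)[OF swap r13 r14] by (elim bexE)
  from s have "s = 0 \<or> s = 1"
    by simp
  with R1 R2 swap show ?thesis
    by (intro exI[of _ x1] exI[of _ x2] exI[of _ x3] exI[of _ x4]) (elim disjE; simp)
next
  case (double_swap x1 x2 x3 x4)
  note e = enumeration_permute(4)[OF double_swap(1)]
  note R1 = entries_double_swap(1)[OF double_swap]
  obtain s t where "s \<in> {0, 1}" "t \<in> {0, 1}"
    and R2: "entries Rho2 x1 x2 x3 x4 = [[s,1-s,1,1], [1-s,s,1,1], [1,1,t,1-t], [1,1,1-t,t]]"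
    using entries_double_swap(2)[OF double_swap] by (elim bexE)
  then have st: "s = 0 \<or> s = 1" "t = 0 \<or> t = 1"
    by simp_all
  show ?thesis
  \<comment> \<open>Exchanging the two swapped pairs turns this solution into the one with
    \<open>s = 0\<close> and \<open>t = 1\<close>.\<close>
  proof (cases "s = 1 \<and> t = 0")
    case True
    with e double_swap R1 R2 show ?thesis
      by (intro exI[of _ x3] exI[of _ x4] exI[of _ x1] exI[of _ x2]) (simp add: entries_def)
  next
    case False
    with st double_swap R1 R2 show ?thesis
      by (intro exI[of _ x1] exI[of _ x2] exI[of _ x3] exI[of _ x4]) (elim disjE; simp)
  qed
qed

end

section \<open>From modules to matrices\<close>

lemma irr_class_mult:
  "irr_class i * irr_class j = (\<Sum>k\<in>constituents i j. irr_class k)"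
  by (cases i; cases j) (simp_all add: r_S4_eq_iff coeff_mult sum_irr all_irr fusion_coeff_def)

lemma constituents_commute: "constituents i j = constituents j i"
  by (cases i; cases j) simp_all

context Z_plus_module
begin

sublocale Z: module "int_scale act"
  using module_axioms by (rule module_int_scale)

abbreviation coord :: "'m \<Rightarrow> 'm \<Rightarrow> int" where
  "coord \<equiv> module.representation (int_scale act) B"

lemma coord_add: "coord (x + y) k = coord x k + coord y k"
  using basis_independent basis_span by (simp add: Z.representation_add)

lemma coord_scale: "coord (int_scale act c x) k = c * coord x k"
  using basis_independent basis_span by (simp add: Z.representation_scale)

lemma coord_sum: "coord (\<Sum>i\<in>I. f i) k = (\<Sum>i\<in>I. coord (f i) k)"
  using basis_independent basis_span by (simp add: Z.representation_sum)

lemma coord_basis: "l \<in> B \<Longrightarrow> coord l k = of_bool (k = l)"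
  using basis_independent by (simp add: Z.representation_basis)

context
  assumes finite_basis: "finite B"
begin

lemma coord_expand: "(\<Sum>k\<in>B. int_scale act (coord x k) k) = x"
  using basis_independent basis_span finite_basis by (intro Z.sum_representation_eq) auto

lemma act_int_scale: "act r (int_scale act c x) = int_scale act c (act r x)"
  by (simp add: int_scale_def mult.commute)

lemma coord_act_irr:
  "coord (act (irr_class i) x) k = (\<Sum>l\<in>B. coord x l * structure_constant act B i l k)"
proof -
  have "act (irr_class i) x = act (irr_class i) (\<Sum>l\<in>B. int_scale act (coord x l) l)"
    by (simp only: coord_expand)
  also have "\<dots> = (\<Sum>l\<in>B. int_scale act (coord x l) (act (irr_class i) l))"
    by (simp add: scale_sum_right act_int_scale)
  finally show ?thesis
    by (simp add: coord_sum coord_scale structure_constant_def)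
qed

lemma coord_act:
  "coord (act r x) k =
    (\<Sum>i\<in>UNIV. coeff r i * (\<Sum>l\<in>B. coord x l * structure_constant act B i l k))"
proof -
  have "act r x = act (\<Sum>i\<in>UNIV. of_int (coeff r i) * irr_class i) x"
    by (simp only: r_S4_expand[symmetric])
  also have "\<dots> = (\<Sum>i\<in>UNIV. int_scale act (coeff r i) (act (irr_class i) x))"
    by (simp add: scale_sum_left int_scale_def)
  finally show ?thesis
    by (simp add: coord_sum coord_scale coord_act_irr)
qed

lemma structure_constant_One:
  assumes "l \<in> B"
  shows "structure_constant act B One l k = of_bool (l = k)"
  using assms by (auto simp: structure_constant_def irr_class_One coord_basis)

text \<open>The sum describes acting by \<open>i\<close> and then by \<open>j\<close>, which is the
  product in the opposite order; commutativity of the ring restores it.\<close>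

lemma structure_constant_mult:
  assumes "l \<in> B"
  shows "(\<Sum>z\<in>B. structure_constant act B i l z * structure_constant act B j z k) =
    (\<Sum>m\<in>constituents i j. structure_constant act B m l k)"
proof -
  have "(\<Sum>z\<in>B. structure_constant act B i l z * structure_constant act B j z k) =
      coord (act (irr_class j) (act (irr_class i) l)) k"
    unfolding coord_act_irr[of j] by (simp add: structure_constant_def)
  also have "act (irr_class j) (act (irr_class i) l) = (\<Sum>m\<in>constituents i j. act (irr_class m) l)"
    by (simp add: irr_class_mult scale_sum_left constituents_commute[of j i])
  finally show ?thesis
    by (simp add: coord_sum structure_constant_def)
qed

text \<open>This turns irreducibility into connectedness. Every ring element is an integer
  combination of the classes \<open>irr_class i\<close>, so closure under these on basis elements is
  enough.\<close>

lemma closed_imp_subspace: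
  assumes "N \<subseteq> B"
    and closed: "\<And>i x y. x \<in> N \<Longrightarrow> y \<in> B - N \<Longrightarrow> structure_constant act B i x y = 0"
  shows "subspace (Z.span N)"
proof -
  have basis: "act r x \<in> Z.span N" if "x \<in> N" for r x
  proof -
    have x: "x \<in> B"
      using assms that by auto
    have "coord (act r x) y = 0" if y: "y \<in> B - N" for y
      using finite_basis x \<open>x \<in> N\<close> y by (simp add: coord_act coord_basis closed if_distrib if_distribR of_bool_def cong: if_cong)
    then have "act r x = (\<Sum>k\<in>N. int_scale act (coord (act r x) k) k)"
      using finite_basis assms(1)
      by (subst coord_expand[symmetric], intro sum.mono_neutral_right) auto
    also have "\<dots> \<in> Z.span N"
      by (intro Z.span_sum Z.span_scale Z.span_base)
    finally show ?thesis .
  qed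
  have "act r x \<in> Z.span N" if "x \<in> Z.span N" for r x
    using that
  proof (induction rule: Z.span_induct_alt)
    case base
    show ?case by (simp add: Z.span_zero)
  next
    case (step c x y)
    then show ?case
      by (simp add: scale_right_distrib act_int_scale Z.span_add Z.span_scale basis)
  qed
  then show ?thesis
    by (simp add: subspace_def Z.span_zero Z.span_add)
qed

text \<open>The isomorphism is the coordinate map along \<open>e\<close>. Matrices act on columns,
  so the source \<open>e l\<close> indexes columns and the target \<open>e k\<close> rows.\<close>

lemma equivalent_matrix_action:
  assumes "module (matrix_action P R1 R2)"
    and e: "bij_betw e (UNIV :: 4 set) B"
    and entry: "\<And>i k l. structure_constant act B i (e l) (e k) = irr_matrix P R1 R2 i $ k $ l"
  shows "equivalent_modules act B (matrix_action P R1 R2) std_basis"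
proof -
  let ?f = "\<lambda>x. \<chi> i. coord x (e i)"
  interpret M: module "matrix_action P R1 R2" by fact
  have e_mem: "e i \<in> B" for i
    using e by (auto simp: bij_betw_def)
  have e_inj: "e i = e j \<longleftrightarrow> i = j" for i j
    using e by (auto simp: bij_betw_def inj_on_def)
  have sum_e: "(\<Sum>l\<in>B. g l) = (\<Sum>i\<in>UNIV. g (e i))" for g :: "'m \<Rightarrow> 'b::comm_monoid_add"
    using sum.reindex_bij_betw[OF e, of g] by simp
  have hom: "module_hom act (matrix_action P R1 R2) ?f"
  proof
    show "?f (x + y) = ?f x + ?f y" for x y
      by (simp add: vec_eq_iff coord_add)
    show "?f (act r x) = matrix_action P R1 R2 r (?f x)" for r x
      by (simp add: vec_eq_iff coord_act matrix_action_def matrix_vector_mult_def sum_e entry mult.commute)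
  qed
  have "bij ?f"
  proof (rule bij_betw_byWitness[where f' = "\<lambda>v. \<Sum>i\<in>UNIV. int_scale act (v $ i) (e i)"])
    show "\<forall>x\<in>UNIV. (\<Sum>i\<in>UNIV. int_scale act (?f x $ i) (e i)) = x"
      using coord_expand by (simp add: sum_e)
    show "\<forall>v\<in>UNIV. ?f (\<Sum>i\<in>UNIV. int_scale act (v $ i) (e i)) = v"
      by (simp add: vec_eq_iff coord_sum coord_scale coord_basis e_mem e_inj if_distrib of_bool_def cong: if_cong)
  qed auto
  moreover have "?f ` B = std_basis"
  proof -
    have "?f (e i) = axis i 1" for i
      by (simp add: vec_eq_iff coord_basis e_mem e_inj axis_def)
    moreover have "B = range e"
      using e by (simp add: bij_betw_def)
    ultimately show ?thesis
      by (simp add: std_basis_def image_image)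
  qed
  ultimately show ?thesis
    using hom unfolding equivalent_modules_def bij_betw_def
    by (intro exI[of _ ?f]) (auto simp: inj_on_def)
qed

end

end

theorem proposition3p4:
  fixes act :: "r_S4 \<Rightarrow> 'm::ab_group_add \<Rightarrow> 'm" and B :: "'m set"
  assumes "based_module act B"
    and "irreducible_Z_plus_module act B"
    and "card B = 4"
  shows "\<exists>N \<in> {M4_1, M4_2, M4_3, M4_4, M4_5, M4_6, M4_7}. equivalent_modules act B N std_basis"
proof -
  interpret based_module act B by fact
  interpret irreducible_Z_plus_module act B by fact
  have fin: "finite B"
    using assms(3) by (simp add: card_ge_0_finite)
  interpret S: symmetric_fusion_action B "structure_constant act B"
  proof
    show "card B = 4" by fact
    fix N assume N: "N \<noteq> {}" "N \<subset> B"
    then have "\<not> subspace (Z.span N)"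
      by (rule no_submodule)
    then show "\<exists>i. \<exists>x\<in>N. \<exists>y\<in>B - N. structure_constant act B i x y \<noteq> 0"
      using closed_imp_subspace[OF fin, of N] N by blast
  qed (use fin structure_constant_One structure_constant_mult structure_constant_nonneg
      structure_constant_sym in blast)+
  have equiv: "equivalent_modules act B (matrix_action (matrix_of_rows p) (matrix_of_rows r1) (matrix_of_rows r2)) std_basis"
    if enum: "S.enumeration x1 x2 x3 x4"
      and ent: "S.entries Psi x1 x2 x3 x4 = p" "S.entries Rho1 x1 x2 x3 x4 = r1" "S.entries Rho2 x1 x2 x3 x4 = r2"
      and "based_module (matrix_action (matrix_of_rows p) (matrix_of_rows r1) (matrix_of_rows r2)) std_basis"
    for x1 x2 x3 x4 p r1 r2
  proof (rule equivalent_matrix_action[OF fin])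
    define e :: "4 \<Rightarrow> 'm" where "e i = (if i = 1 then x1 else if i = 2 then x2 else if i = 3 then x3 else x4)" for i
    note B = S.mem[OF enum]
    have e: "e 1 = x1" "e 2 = x2" "e 3 = x3" "e 4 = x4"
      by (simp_all add: e_def)
    show "module (matrix_action (matrix_of_rows p) (matrix_of_rows r1) (matrix_of_rows r2))"
      using that(5) by (simp add: based_module_def Z_plus_module_def)
    have "inj e"
      unfolding inj_def forall_4 e using S.diff[OF enum] by simp
    moreover have "range e = B"
      unfolding UNIV_4 using enum by (simp add: e S.enumeration_def)
    ultimately show bij: "bij_betw e UNIV B"
      by (simp add: bij_betw_def)
    \<comment> \<open>\<open>entries\<close> puts the source in the row, the action puts it in the
      column; symmetry reconciles the two.\<close>
    have entries: "\<forall>k l. structure_constant act B i (e l) (e k) = matrix_of_rows (S.entries i x1 x2 x3 x4) $ k $ l" for i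
      unfolding forall_4 e S.entries_def list.map matrix_of_rows_nth vector_4_nth
      using structure_constant_sym B by auto
    have Rho3: "structure_constant act B Rho3 (e l) (e k) = (matrix_of_rows p ** matrix_of_rows r2) $ k $ l" for k l
    proof -
      have "(matrix_of_rows p ** matrix_of_rows r2) $ k $ l =
          (\<Sum>m\<in>UNIV. structure_constant act B Rho2 (e l) (e m) * structure_constant act B Psi (e m) (e k))"
        unfolding matrix_matrix_mult_def using entries[of Psi] entries[of Rho2]
        by (simp add: ent mult.commute)
      also have "\<dots> = (\<Sum>z\<in>B. structure_constant act B Rho2 (e l) z * structure_constant act B Psi z (e k))"
        by (rule sum.reindex_bij_betw[OF bij])
      also have "\<dots> = structure_constant act B Rho3 (e l) (e k)"
        using bij by (subst structure_constant_mult[OF fin]) (auto simp: bij_betw_def)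
      finally show ?thesis by simp
    qed
    have One: "structure_constant act B One (e l) (e k) = (mat 1 :: int^4^4) $ k $ l" for k l
      using bij by (subst structure_constant_One[OF fin]) (auto simp: bij_betw_def inj_on_def mat_def)
    show "structure_constant act B i (e l) (e k) =
      irr_matrix (matrix_of_rows p) (matrix_of_rows r1) (matrix_of_rows r2) i $ k $ l" for i k l
      using entries[of Psi] entries[of Rho1] entries[of Rho2]
      by (cases i) (simp_all add: One Rho3 ent)
  qed
  \<comment> \<open>\<open>M4_1\<close> and \<open>M4_2\<close> are defined with scalar matrices,
    which are expanded to match the lists of \<open>classification\<close>.\<close>
  have mats: "mat 1 = matrix_of_rows [[1,0,0,0], [0,1,0,0], [0,0,1,0], [0,0,0,1]]"
      "mat 2 = matrix_of_rows [[2,0,0,0], [0,2,0,0], [0,0,2,0], [0,0,0,2]]"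
    by (simp_all only: matrix_of_rows_simps)
  note defs = M4_1_def M4_2_def M4_3_def M4_4_def M4_5_def M4_6_def M4_7_def mats
  from S.classification show ?thesis
    unfolding defs
    by (elim exE conjE insertE emptyE Pair_inject)
      (rule bexI, rule equiv, assumption+, rule based_modules[unfolded defs], simp)+
qed

end
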